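(* Let $k$ be any field, let $A$ be a finitely generated commutative $k$-algebra, and let $S$ be the set of all $f\in A$ such that $\varphi(f)\neq 0$ for all $k$-algebra morphisms $\varphi:A\to k$. Every ideal $I$ of $A$ which is disjoint from $S$ and maximal among the ideals of $A$ disjoint from $S$ is a maximal ideal of $A$ such that $A/I\cong k$ as $k$-algebras. Reciprocally, every maximal ideal $I$ of $A$ such that $A/I\cong k$ as $k$-algebras is disjoint from $S$ and maximal among the ideals of $A$ disjoint from $S$.
   Context: All rings and algebras are commutative and unital; $k$ is not assumed algebraically closed. If there is no $k$-morphism $A\to k$, then $S=A$. *)

theory Defs
  imports "HOL-Algebra.Algebra"
begin

text \<open>
  Commutative unital algebras over a commutative ring \<open>K\<close> are given by the library locale
  \<^locale>\<open>algebra\<close>, whose second argument is a \<open>module\<close> record: a ring together with a scalar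
  multiplication. The zero algebra is allowed.
\<close>

text \<open>Ring homomorphisms in \<open>ring_hom\<close> preserve the unit.\<close>

definition alg_hom ::
  "('k, 'm) ring_scheme \<Rightarrow> ('k, 'a, 'n) module_scheme \<Rightarrow> ('k, 'b, 'p) module_scheme \<Rightarrow> ('a \<Rightarrow> 'b) set"
  where "alg_hom K A B =
    {h \<in> ring_hom A B. \<forall>c\<in>carrier K. \<forall>x\<in>carrier A. h (c \<odot>\<^bsub>A\<^esub> x) = c \<odot>\<^bsub>B\<^esub> h x}"

definition alg_isomorphic ::
  "('k, 'm) ring_scheme \<Rightarrow> ('k, 'a, 'n) module_scheme \<Rightarrow> ('k, 'b, 'p) module_scheme \<Rightarrow> bool"
  where "alg_isomorphic K A B \<longleftrightarrow> (\<exists>h \<in> alg_hom K A B. bij_betw h (carrier A) (carrier B))"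

definition self_algebra :: "('k, 'm) ring_scheme \<Rightarrow> ('k, 'k) module"
  where "self_algebra K =
    \<lparr>carrier = carrier K, monoid.mult = (\<otimes>\<^bsub>K\<^esub>), one = \<one>\<^bsub>K\<^esub>, ring.zero = \<zero>\<^bsub>K\<^esub>,
     ring.add = (\<oplus>\<^bsub>K\<^esub>), smult = (\<otimes>\<^bsub>K\<^esub>)\<rparr>"

text \<open>
  The quotient algebra is the library's quotient ring with scalar multiplication on cosets given,
  in the style of \<open>rcoset_mult\<close>, by a union over representatives; for an ideal \<open>I\<close> this is
  \<open>c \<odot> (I +> x) = I +> (c \<odot> x)\<close>, see \<open>quot_algebra_smult\<close> below.
\<close>

definition quot_algebra :: "('k, 'a, 'n) module_scheme \<Rightarrow> 'a set \<Rightarrow> ('k, 'a set) module"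
  where "quot_algebra A I =
    \<lparr>carrier = carrier (A Quot I), monoid.mult = (\<otimes>\<^bsub>A Quot I\<^esub>), one = \<one>\<^bsub>A Quot I\<^esub>,
     ring.zero = \<zero>\<^bsub>A Quot I\<^esub>, ring.add = (\<oplus>\<^bsub>A Quot I\<^esub>),
     smult = (\<lambda>c C. \<Union>x\<in>C. I +>\<^bsub>A\<^esub> (c \<odot>\<^bsub>A\<^esub> x))\<rparr>"

text \<open>
  The library's \<^locale>\<open>subalgebra\<close> requires closure under addition and scalars only and is
  about subsets of a single ring, so subalgebras are introduced here.
\<close>

definition is_subalgebra :: "('k, 'm) ring_scheme \<Rightarrow> ('k, 'a, 'n) module_scheme \<Rightarrow> 'a set \<Rightarrow> bool"
  where "is_subalgebra K A B \<longleftrightarrow>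
    subring B A \<and> (\<forall>c\<in>carrier K. \<forall>x\<in>B. c \<odot>\<^bsub>A\<^esub> x \<in> B)"

definition fg_algebra :: "('k, 'm) ring_scheme \<Rightarrow> ('k, 'a, 'n) module_scheme \<Rightarrow> bool"
  where "fg_algebra K A \<longleftrightarrow> algebra K A \<and>
    (\<exists>G. finite G \<and> G \<subseteq> carrier A \<and> \<Inter>{B. is_subalgebra K A B \<and> G \<subseteq> B} = carrier A)"

definition nonvanishing :: "('k, 'm) ring_scheme \<Rightarrow> ('k, 'a, 'n) module_scheme \<Rightarrow> 'a set"
  where "nonvanishing K A =
    {f \<in> carrier A. \<forall>\<phi> \<in> alg_hom K A (self_algebra K). \<phi> f \<noteq> \<zero>\<^bsub>K\<^esub>}"

definition maximal_disjoint_ideal :: "('a, 'n) ring_scheme \<Rightarrow> 'a set \<Rightarrow> 'a set \<Rightarrow> bool"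
  where "maximal_disjoint_ideal A S I \<longleftrightarrow>
    ideal I A \<and> I \<inter> S = {} \<and> (\<forall>J. ideal J A \<and> J \<inter> S = {} \<and> I \<subseteq> J \<longrightarrow> J = I)"

lemma self_algebra_algebra:
  assumes "cring K"
  shows "algebra K (self_algebra K)"
proof -
  interpret cring K by fact
  have "cring (self_algebra K)"
    by (rule cringI, rule abelian_groupI, rule_tac [7] comm_monoidI)
       (simp_all add: self_algebra_def a_assoc m_assoc l_distr, (rule a_comm m_comm; assumption)+)
  then show ?thesis
    by (intro algebraI)
       (auto simp: self_algebra_def assms l_distr r_distr m_assoc)
qed

lemma quot_algebra_smult:
  assumes "algebra K A" "ideal I A" "c \<in> carrier K" "x \<in> carrier A"
  shows "c \<odot>\<^bsub>quot_algebra A I\<^esub> (I +>\<^bsub>A\<^esub> x) = I +>\<^bsub>A\<^esub> (c \<odot>\<^bsub>A\<^esub> x)"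
proof -
  interpret algebra K A by fact
  interpret I: ideal I A by fact
  have *: "I +>\<^bsub>A\<^esub> (c \<odot>\<^bsub>A\<^esub> y) = I +>\<^bsub>A\<^esub> (c \<odot>\<^bsub>A\<^esub> x)" if y: "y \<in> I +>\<^bsub>A\<^esub> x" for y
  proof -
    obtain i where i: "i \<in> I" "y = i \<oplus>\<^bsub>A\<^esub> x"
      using y unfolding a_r_coset_def' by blast
    then have iA: "i \<in> carrier A" by (simp add: I.a_Hcarr)
    have "(c \<odot>\<^bsub>A\<^esub> \<one>\<^bsub>A\<^esub>) \<otimes>\<^bsub>A\<^esub> i \<in> I"
      using assms i by (intro I.I_l_closed) simp_all
    then have "c \<odot>\<^bsub>A\<^esub> i \<in> I"
      using assms iA by (simp add: smult_assoc2)
    moreover have "c \<odot>\<^bsub>A\<^esub> y = c \<odot>\<^bsub>A\<^esub> i \<oplus>\<^bsub>A\<^esub> c \<odot>\<^bsub>A\<^esub> x"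
      using i iA assms by (simp add: smult_r_distr)
    ultimately have "c \<odot>\<^bsub>A\<^esub> y \<in> I +>\<^bsub>A\<^esub> (c \<odot>\<^bsub>A\<^esub> x)"
      using i unfolding a_r_coset_def' by blast
    then show ?thesis
      using I.a_repr_independence' assms smult_closed by metis
  qed
  have "x \<in> I +>\<^bsub>A\<^esub> x"
    using assms I.a_rcos_self by blast
  then have "(\<Union>y\<in>I +>\<^bsub>A\<^esub> x. I +>\<^bsub>A\<^esub> (c \<odot>\<^bsub>A\<^esub> y)) = I +>\<^bsub>A\<^esub> (c \<odot>\<^bsub>A\<^esub> x)"
    using * by blast
  then show ?thesis
    by (simp add: quot_algebra_def)
qed

lemma quot_algebra_algebra:
  assumes "algebra K A" "ideal I A"
  shows "algebra K (quot_algebra A I)"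
proof -
  interpret algebra K A by fact
  interpret I: ideal I A by fact
  interpret Q: cring "A Quot I"
    by (rule I.quotient_is_cring) (rule M_cring)
  have cr: "cring (quot_algebra A I)"
    by (rule cringI, rule abelian_groupI, rule_tac [7] comm_monoidI)
       (simp_all add: quot_algebra_def Q.a_assoc Q.m_assoc Q.l_distr Q.add.l_inv_ex,
        (rule Q.a_comm Q.m_comm; assumption)+)
  have carr: "\<exists>x\<in>carrier A. C = I +>\<^bsub>A\<^esub> x" if "C \<in> carrier (quot_algebra A I)" for C
    using that by (auto simp: quot_algebra_def FactRing_simps)
  have mem: "I +>\<^bsub>A\<^esub> x \<in> carrier (quot_algebra A I)" if "x \<in> carrier A" for x
    using that by (auto simp: quot_algebra_def FactRing_simps)
  have add: "(I +>\<^bsub>A\<^esub> x) \<oplus>\<^bsub>quot_algebra A I\<^esub> (I +>\<^bsub>A\<^esub> y) = I +>\<^bsub>A\<^esub> (x \<oplus>\<^bsub>A\<^esub> y)"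
    if "x \<in> carrier A" "y \<in> carrier A" for x y
    using that by (simp add: quot_algebra_def FactRing_def I.a_rcos_sum)
  have mult: "(I +>\<^bsub>A\<^esub> x) \<otimes>\<^bsub>quot_algebra A I\<^esub> (I +>\<^bsub>A\<^esub> y) = I +>\<^bsub>A\<^esub> (x \<otimes>\<^bsub>A\<^esub> y)"
    if "x \<in> carrier A" "y \<in> carrier A" for x y
    using that by (simp add: quot_algebra_def FactRing_def I.rcoset_mult_add)
  note sm = quot_algebra_smult[OF assms]
  show ?thesis
  proof (rule algebraI[OF R_cring cr], goal_cases)
    case (1 a P)
    then obtain x where "x \<in> carrier A" "P = I +>\<^bsub>A\<^esub> x"
      using carr by metis
    with 1 show ?case by (simp add: sm mem)
  next
    case (2 a b P)
    then obtain x where "x \<in> carrier A" "P = I +>\<^bsub>A\<^esub> x"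
      using carr by metis
    with 2 show ?case by (simp add: sm add smult_l_distr)
  next
    case (3 a P Q)
    then obtain x y where "x \<in> carrier A" "y \<in> carrier A" "P = I +>\<^bsub>A\<^esub> x" "Q = I +>\<^bsub>A\<^esub> y"
      using carr by metis
    with 3 show ?case by (simp add: sm add smult_r_distr)
  next
    case (4 a b P)
    then obtain x where "x \<in> carrier A" "P = I +>\<^bsub>A\<^esub> x"
      using carr by metis
    with 4 show ?case by (simp add: sm smult_assoc1)
  next
    case (5 P)
    then obtain x where "x \<in> carrier A" "P = I +>\<^bsub>A\<^esub> x"
      using carr by metis
    then show ?case by (simp add: sm)
  next
    case (6 a P Q)
    then obtain x y where "x \<in> carrier A" "y \<in> carrier A" "P = I +>\<^bsub>A\<^esub> x" "Q = I +>\<^bsub>A\<^esub> y"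
      using carr by metis
    with 6 show ?case by (simp add: sm mult smult_assoc2)
  qed
qed

end

theory Submission
  imports Defs
begin

text \<open>
  The point is that an ideal \<open>I\<close> disjoint from the set \<open>S\<close> is killed by some algebra homomorphism
  \<open>h : A \<rightarrow> K\<close>; then \<open>I\<close> lies in the kernel of \<open>h\<close>, which is disjoint from \<open>S\<close> and maximal with
  residue field \<open>K\<close>.

  If some monic polynomial of positive degree has no root in \<open>K\<close>, its homogenization is a binary
  form with only the trivial zero. Iterating it merges finitely many generators of \<open>I\<close>, which exist
  by Hilbert's basis theorem, into a single \<open>g \<in> I\<close> such that every \<open>h\<close> with \<open>h g = 0\<close> kills \<open>I\<close>,
  and \<open>g \<notin> S\<close> provides such an \<open>h\<close>.

  If \<open>K\<close> is algebraically closed, \<open>I\<close> is proper because \<open>1 \<in> S\<close>, so Zariski's lemma for a maximal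
  ideal above \<open>I\<close> applies. For the latter, suppose the field \<open>F = D[x\<^sub>1, \<dots>, x\<^sub>n]\<close> is algebraic over
  \<open>E = E'[t]\<close> with \<open>t\<close> transcendental over \<open>E'\<close>. Then \<open>F\<close> is a finite module over some localization
  \<open>E[1/a]\<close>, so by Nakayama every nonzero \<open>u \<in> E\<close> divides a power of \<open>a\<close>; but \<open>u = 1 + t a\<close> is coprime
  to \<open>a\<close> and not a unit.
\<close>

section \<open>Spans over a subring and simple extensions\<close>

text \<open>A maximal ideal above \<open>I\<close> may have a residue field larger than
  \<open>K\<close>, so properness of \<open>I\<close> does not produce \<open>h\<close> in general.
  Disjointness from \<open>S\<close> does better, but it speaks of one element of \<open>I\<close>
  at a time, whereas \<open>h\<close> has to kill all of them at once. A binary form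
  \<open>N\<close> with only the trivial zero closes this gap, because
  \<open>h (N (g, b)) = N (h g, h b)\<close>. Over an algebraically closed field every binary form
  of positive degree has a nontrivial zero, whence the case distinction; there all residue fields
  are \<open>K\<close> itself.

  Everything takes place inside one ring, relative to its subrings. Linear relations between powers
  replace polynomial rings, fraction fields and localizations: the span of
  \<open>exp_base x n\<close> plays the polynomials of degree below \<open>n\<close>, and instead of
  dividing by \<open>a\<close> one multiplies by a power of \<open>a\<close>.\<close>

definition (in ring) submod :: "'a set \<Rightarrow> 'a set \<Rightarrow> bool" where
  "submod D M \<longleftrightarrow> M \<subseteq> carrier R \<and> \<zero> \<in> M \<and> (\<forall>u\<in>M. \<forall>v\<in>M. u \<oplus> v \<in> M) \<and> (\<forall>d\<in>D. \<forall>u\<in>M. d \<otimes> u \<in> M)"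

text \<open>The ideals of \<open>D\<close> are the \<open>submod D\<close> sets inside
  \<open>D\<close>. Phrasing their finite generation by \<open>Span\<close> lets the notion apply to
  a subring without making it a ring record of its own.\<close>

definition (in ring) noetherian_subring :: "'a set \<Rightarrow> bool" where
  "noetherian_subring D \<longleftrightarrow> subring D R \<and>
     (\<forall>J. submod D J \<and> J \<subseteq> D \<longrightarrow> (\<exists>bs. set bs \<subseteq> J \<and> J \<subseteq> Span D bs))"

text \<open>\<open>exp_base x n\<close> lists the powers of \<open>x\<close> below \<open>x ^ n\<close>, so \<open>x\<close> is a root of a polynomial over \<open>D\<close>
  with leading coefficient \<open>a\<close>.\<close>

definition (in ring) algebraic_at :: "'a set \<Rightarrow> 'a \<Rightarrow> 'a \<Rightarrow> bool" where
  "algebraic_at D a x \<longleftrightarrow> (\<exists>n. a \<otimes> x [^] n \<in> Span D (exp_base x n))"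

context cring
begin

lemma submodI:
  assumes "M \<subseteq> carrier R" "\<zero> \<in> M" "\<And>u v. u \<in> M \<Longrightarrow> v \<in> M \<Longrightarrow> u \<oplus> v \<in> M"
    "\<And>d u. d \<in> D \<Longrightarrow> u \<in> M \<Longrightarrow> d \<otimes> u \<in> M"
  shows "submod D M"
  using assms unfolding submod_def by blast

lemma submodE:
  assumes "submod D M"
  shows "M \<subseteq> carrier R" "\<zero> \<in> M" "\<And>u v. u \<in> M \<Longrightarrow> v \<in> M \<Longrightarrow> u \<oplus> v \<in> M"
    "\<And>d u. d \<in> D \<Longrightarrow> u \<in> M \<Longrightarrow> d \<otimes> u \<in> M"
  using assms unfolding submod_def by blast+

lemma submod_minus:
  assumes "subring D R" "submod D M" "u \<in> M"
  shows "\<ominus> u \<in> M"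
proof -
  have u: "u \<in> carrier R" using assms submodE(1) by blast
  have "(\<ominus> \<one>) \<otimes> u \<in> M" using assms submodE(4) subringE(3,5) by metis
  then show ?thesis using u by (simp add: l_minus)
qed

lemma submod_diff:
  assumes "subring D R" "submod D M" "u \<in> M" "v \<in> M"
  shows "u \<ominus> v \<in> M"
  using assms submod_minus submodE(3) unfolding a_minus_def by metis

lemma submod_mono: "submod E M \<Longrightarrow> D \<subseteq> E \<Longrightarrow> submod D M"
  unfolding submod_def by blast

lemma mem_Span_Cons: "y \<in> Span D (b # bs) \<longleftrightarrow> (\<exists>d\<in>D. \<exists>v\<in>Span D bs. y = d \<otimes> b \<oplus> v)"
  by (simp add: line_extension_mem_iff)

lemma mem_Span_Nil: "y \<in> Span D [] \<longleftrightarrow> y = \<zero>"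
  by simp

text \<open>Spans are handled through the two membership rules above; as a simp rule the definition
  would be unfolded on sight.\<close>

declare Span.simps [simp del]

lemma submod_Span:
  assumes "subring D R" "set bs \<subseteq> carrier R"
  shows "submod D (Span D bs)"
  using assms(2)
proof (induction bs)
  case Nil
  then show ?case using subringE(1)[OF assms(1)] by (auto intro!: submodI simp: mem_Span_Nil)
next
  case (Cons b bs)
  then have b: "b \<in> carrier R" and IH: "submod D (Span D bs)" by auto
  note D = subringE[OF assms(1)]
  show ?case
  proof (rule submodI)
    show "Span D (b # bs) \<subseteq> carrier R" using Span_in_carrier[OF D(1) Cons.prems] .
    have "\<zero> = \<zero> \<otimes> b \<oplus> \<zero>" using b by simp
    then show "\<zero> \<in> Span D (b # bs)" using D(2) submodE(2)[OF IH] unfolding mem_Span_Cons by blast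
  next
    fix u v assume "u \<in> Span D (b # bs)" "v \<in> Span D (b # bs)"
    then obtain d e u' v' where *: "d \<in> D" "e \<in> D" "u' \<in> Span D bs" "v' \<in> Span D bs"
      "u = d \<otimes> b \<oplus> u'" "v = e \<otimes> b \<oplus> v'" unfolding mem_Span_Cons by blast
    then have c: "d \<in> carrier R" "e \<in> carrier R" "u' \<in> carrier R" "v' \<in> carrier R"
      using D(1) submodE(1)[OF IH] by auto
    have "u \<oplus> v = (d \<oplus> e) \<otimes> b \<oplus> (u' \<oplus> v')" using c b unfolding *(5,6) by algebra
    then show "u \<oplus> v \<in> Span D (b # bs)"
      using * D(7) submodE(3)[OF IH] unfolding mem_Span_Cons by blast
  next
    fix d u assume "d \<in> D" "u \<in> Span D (b # bs)"
    then obtain e u' where *: "d \<in> D" "e \<in> D" "u' \<in> Span D bs"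
      "u = e \<otimes> b \<oplus> u'" unfolding mem_Span_Cons by blast
    then have c: "d \<in> carrier R" "e \<in> carrier R" "u' \<in> carrier R"
      using D(1) submodE(1)[OF IH] by auto
    have "d \<otimes> u = (d \<otimes> e) \<otimes> b \<oplus> (d \<otimes> u')" using c b unfolding *(4) by algebra
    then show "d \<otimes> u \<in> Span D (b # bs)"
      using * D(6) submodE(4)[OF IH] unfolding mem_Span_Cons by blast
  qed
qed

lemma Span_Cons_superset:
  assumes "subring D R" "b \<in> carrier R" "set bs \<subseteq> carrier R" "v \<in> Span D bs"
  shows "v \<in> Span D (b # bs)"
proof -
  have "v \<in> carrier R" using assms submodE(1)[OF submod_Span] by blast
  then have "v = \<zero> \<otimes> b \<oplus> v" using assms by simp
  then show ?thesis using assms(4) subringE(2)[OF assms(1)] unfolding mem_Span_Cons by blast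
qed

lemma set_subset_Span:
  assumes "subring D R" "set bs \<subseteq> carrier R"
  shows "set bs \<subseteq> Span D bs"
  using assms(2)
proof (induction bs)
  case (Cons b bs)
  have "b = \<one> \<otimes> b \<oplus> \<zero>" using Cons.prems by simp
  moreover have "\<zero> \<in> Span D bs" using Cons.prems submodE(2)[OF submod_Span[OF assms(1)]] by simp
  ultimately have "b \<in> Span D (b # bs)"
    using subringE(3)[OF assms(1)] unfolding mem_Span_Cons by blast
  then show ?case using Cons Span_Cons_superset[OF assms(1)] by auto
qed simp

lemma Span_least:
  assumes "submod D M" "set bs \<subseteq> M"
  shows "Span D bs \<subseteq> M"
  using assms(2)
proof (induction bs)
  case Nil
  then show ?case using submodE(2)[OF assms(1)] by (auto simp: mem_Span_Nil)
next
  case (Cons b bs)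
  then show ?case using submodE(3,4)[OF assms(1)] unfolding subset_iff mem_Span_Cons by fastforce
qed

lemma Span_mono:
  assumes "subring D R" "set cs \<subseteq> carrier R" "set bs \<subseteq> set cs"
  shows "Span D bs \<subseteq> Span D cs"
  using assms submod_Span set_subset_Span by (meson Span_least order_trans)

lemma Span_base_mono:
  assumes "D \<subseteq> E" "subring E R" "set bs \<subseteq> carrier R"
  shows "Span D bs \<subseteq> Span E bs"
  using assms Span_least submod_mono submod_Span set_subset_Span by metis

text \<open>Together with \<open>Span_least\<close> this reduces a claim on
  \<open>x \<otimes> y\<close> for all \<open>y\<close> in a span to the generators of the
  span.\<close>

lemma submod_preimage_mult:
  assumes "D \<subseteq> carrier R" "submod D M" "x \<in> carrier R"
  shows "submod D {y \<in> carrier R. x \<otimes> y \<in> M}"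
proof -
  note M = submodE[OF assms(2)]
  show ?thesis
  proof (rule submodI)
    fix d u assume *: "d \<in> D" "u \<in> {y \<in> carrier R. x \<otimes> y \<in> M}"
    then have "d \<in> carrier R" "u \<in> carrier R" using assms by auto
    moreover from this have "x \<otimes> (d \<otimes> u) = d \<otimes> (x \<otimes> u)" using assms by algebra
    ultimately show "d \<otimes> u \<in> {y \<in> carrier R. x \<otimes> y \<in> M}" using * M(4) by auto
  qed (use assms M in \<open>auto simp: r_distr\<close>)
qed

section \<open>Powers of one element and the filtration of a simple extension by degree\<close>

lemma exp_base_Suc: "exp_base x (Suc n) = x [^] n # exp_base x n"
  by (simp add: exp_base_def)

lemma exp_base_0: "exp_base x 0 = []"
  by (simp add: exp_base_def)

lemma set_exp_base: "set (exp_base x n) = {x [^] i |i. i < n}"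
  by (auto simp: exp_base_def)

lemma exp_base_in_carrier: "x \<in> carrier R \<Longrightarrow> set (exp_base x n) \<subseteq> carrier R"
  by (auto simp: set_exp_base)

lemma submod_Span_exp:
  "subring D R \<Longrightarrow> x \<in> carrier R \<Longrightarrow> submod D (Span D (exp_base x n))"
  by (simp add: submod_Span exp_base_in_carrier)

lemma Span_exp_mono:
  assumes "subring D R" "x \<in> carrier R" "m \<le> n"
  shows "Span D (exp_base x m) \<subseteq> Span D (exp_base x n)"
  using assms by (intro Span_mono) (auto simp: set_exp_base)

lemma pow_in_Span_exp:
  assumes "subring D R" "x \<in> carrier R" "i < n"
  shows "x [^] i \<in> Span D (exp_base x n)"
  using set_subset_Span[OF assms(1) exp_base_in_carrier[OF assms(2)], of n] assms(3)
  by (auto simp: set_exp_base)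

lemma Span_exp_shift:
  assumes "subring D R" "x \<in> carrier R" "y \<in> Span D (exp_base x n)"
  shows "x [^] (k::nat) \<otimes> y \<in> Span D (exp_base x (k + n))"
proof -
  have "set (exp_base x n) \<subseteq> {y \<in> carrier R. x [^] k \<otimes> y \<in> Span D (exp_base x (k + n))}"
    using assms by (auto simp: set_exp_base nat_pow_mult intro!: pow_in_Span_exp)
  then have "Span D (exp_base x n) \<subseteq> {y \<in> carrier R. x [^] k \<otimes> y \<in> Span D (exp_base x (k + n))}"
    using assms by (intro Span_least submod_preimage_mult submod_Span_exp subringE(1)) auto
  then show ?thesis using assms by blast
qed

text \<open>The factors have degree below \<open>m\<close> and below \<open>n\<close>; the bound
  \<open>m + n\<close> is generous by one and avoids the truncated \<open>m + n - 1\<close>.\<close>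

lemma Span_exp_mult:
  assumes "subring D R" "x \<in> carrier R" "y \<in> Span D (exp_base x m)" "z \<in> Span D (exp_base x n)"
  shows "y \<otimes> z \<in> Span D (exp_base x (m + n))"
proof -
  have z: "z \<in> carrier R" using assms submodE(1)[OF submod_Span_exp] by blast
  have "set (exp_base x m) \<subseteq> {y \<in> carrier R. z \<otimes> y \<in> Span D (exp_base x (m + n))}"
  proof clarify
    fix y assume "y \<in> set (exp_base x m)"
    then obtain i where i: "i < m" "y = x [^] i" by (auto simp: set_exp_base)
    have "x [^] i \<otimes> z \<in> Span D (exp_base x (i + n))" using assms Span_exp_shift by blast
    then have "x [^] i \<otimes> z \<in> Span D (exp_base x (m + n))"
      using Span_exp_mono[of D x "i + n" "m + n"] assms i by auto
    then show "y \<in> carrier R \<and> z \<otimes> y \<in> Span D (exp_base x (m + n))"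
      using z assms i by (simp add: m_comm)
  qed
  then have "Span D (exp_base x m) \<subseteq> {y \<in> carrier R. z \<otimes> y \<in> Span D (exp_base x (m + n))}"
    using assms z by (intro Span_least submod_preimage_mult submod_Span_exp subringE(1)) auto
  then have "y \<in> carrier R" "z \<otimes> y \<in> Span D (exp_base x (m + n))" using assms by blast+
  then show ?thesis using z m_comm by metis
qed

text \<open>\<open>simple_extension\<close> is defined inductively by Horner steps
  \<open>y \<otimes> x \<oplus> d\<close>. Written as an increasing union of spans it acquires a
  degree on which later inductions run.\<close>

lemma simple_extension_eq_Span:
  assumes "subring D R" "x \<in> carrier R"
  shows "simple_extension D x = (\<Union>n. Span D (exp_base x n))"
proof
  note D = subringE[OF assms(1)]
  show "simple_extension D x \<subseteq> (\<Union>n. Span D (exp_base x n))"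
  proof
    fix y assume "y \<in> simple_extension D x"
    then show "y \<in> (\<Union>n. Span D (exp_base x n))"
    proof induction
      case zero
      then show ?case using submodE(2)[OF submod_Span_exp] assms by blast
    next
      case (lin y d)
      then obtain n where n: "y \<in> Span D (exp_base x n)" by blast
      then have y: "y \<in> carrier R" using assms submodE(1)[OF submod_Span_exp] by blast
      have "y \<otimes> x \<in> Span D (exp_base x (Suc n))"
        using Span_exp_shift[OF assms n, of 1] y assms by (simp add: m_comm)
      moreover have "d \<otimes> x [^] (0::nat) \<in> Span D (exp_base x (Suc n))"
        using lin assms by (intro submodE(4)[OF submod_Span_exp] pow_in_Span_exp) auto
      ultimately have "y \<otimes> x \<oplus> d \<in> Span D (exp_base x (Suc n))"
        using submodE(3)[OF submod_Span_exp[OF assms]] lin D(1) by auto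
      then show ?case by blast
    qed
  qed
  have inc: "d \<otimes> x [^] (n::nat) \<in> simple_extension D x" if "d \<in> D" for d n
  proof (induction n)
    case 0
    have "\<zero> \<otimes> x \<oplus> d \<in> simple_extension D x" using that by (simp add: simple_extension.lin)
    then show ?case using that assms D(1) by auto
  next
    case (Suc n)
    have d: "d \<in> carrier R" using that D(1) by blast
    have "d \<otimes> x [^] n \<otimes> x \<oplus> \<zero> \<in> simple_extension D x" using Suc D(2) by (simp add: simple_extension.lin)
    then show ?case using d assms by (simp add: m_assoc)
  qed
  have car: "simple_extension D x \<subseteq> carrier R" using simple_extension_in_carrier D(1) assms(2) .
  have add: "u \<oplus> v \<in> simple_extension D x" if "u \<in> simple_extension D x" "v \<in> simple_extension D x" for u v
    using that(2,1)
  proof (induction v arbitrary: u)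
    case zero
    then show ?case using car by auto
  next
    case (lin v d)
    from lin.prems show ?case
    proof cases
      case zero
      then have "u \<oplus> (v \<otimes> x \<oplus> d) = v \<otimes> x \<oplus> d" using lin car assms D(1) by (auto simp: subset_iff)
      then show ?thesis using lin.hyps by (simp add: simple_extension.lin)
    next
      case (lin u' e)
      have "u' \<in> carrier R" "v \<in> carrier R" "d \<in> carrier R" "e \<in> carrier R"
        using lin \<open>v \<in> _\<close> \<open>d \<in> D\<close> car D(1) by auto
      then have "u \<oplus> (v \<otimes> x \<oplus> d) = (u' \<oplus> v) \<otimes> x \<oplus> (e \<oplus> d)"
        unfolding lin(1) using assms(2) by algebra
      then show ?thesis using lin lin.IH \<open>d \<in> D\<close> D(7) by (simp add: simple_extension.lin)
    qed
  qed
  have "Span D (exp_base x n) \<subseteq> simple_extension D x" for n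
  proof (induction n)
    case (Suc n)
    then show ?case using add inc unfolding exp_base_Suc subset_iff mem_Span_Cons by auto
  qed (auto simp: exp_base_0 mem_Span_Nil)
  then show "(\<Union>n. Span D (exp_base x n)) \<subseteq> simple_extension D x" by blast
qed

lemma subring_simple_extension:
  assumes "subring D R" "x \<in> carrier R"
  shows "subring (simple_extension D x) R"
proof -
  note D = subringE[OF assms(1)]
  let ?P = "\<lambda>n. Span D (exp_base x n)"
  note eq = simple_extension_eq_Span[OF assms]
  note sm = submod_Span_exp[OF assms]
  show ?thesis
  proof (rule subringI)
    show "simple_extension D x \<subseteq> carrier R" using simple_extension_in_carrier D(1) assms(2) .
    show "\<one> \<in> simple_extension D x"
      using simple_extension_incl[OF D(1) assms(2)] D(3) by blast
    show "\<ominus> h \<in> simple_extension D x" if "h \<in> simple_extension D x" for h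
      using that submod_minus[OF assms(1) sm] unfolding eq by blast
    fix h k assume "h \<in> simple_extension D x" "k \<in> simple_extension D x"
    then obtain m n where mn: "h \<in> ?P m" "k \<in> ?P n" unfolding eq by blast
    show "h \<otimes> k \<in> simple_extension D x" using Span_exp_mult[OF assms mn] unfolding eq by blast
    have "h \<in> ?P (max m n)" "k \<in> ?P (max m n)"
      using mn Span_exp_mono[OF assms, of m "max m n"] Span_exp_mono[OF assms, of n "max m n"] by auto
    then show "h \<oplus> k \<in> simple_extension D x" using submodE(3)[OF sm] unfolding eq by blast
  qed
qed

lemma subring_finite_extension:
  "subring D R \<Longrightarrow> set xs \<subseteq> carrier R \<Longrightarrow> subring (finite_extension D xs) R"
  by (induction xs) (auto intro: subring_simple_extension)

end

section \<open>Hilbert's basis theorem\<close>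

text \<open>As \<open>x\<close> may satisfy relations over \<open>D\<close>, an element of
  \<open>J\<close> can have several leading coefficients in several degrees. All representations
  count, and \<open>a\<close> may be zero, so no polynomial ring mapping onto \<open>D[x]\<close>
  has to be introduced.\<close>

definition (in ring) leading_coeffs :: "'a set \<Rightarrow> 'a \<Rightarrow> 'a set \<Rightarrow> nat \<Rightarrow> 'a set" where
  "leading_coeffs D x J n = {a \<in> D. \<exists>y\<in>Span D (exp_base x n). a \<otimes> x [^] n \<oplus> y \<in> J}"

context cring
begin

lemma submod_leading_coeffs:
  assumes "subring D R" "x \<in> carrier R" "submod D J"
  shows "submod D (leading_coeffs D x J n)"
proof -
  note D = subringE[OF assms(1)]
  note P = submodE[OF submod_Span_exp[OF assms(1,2), of n]]
  note J = submodE[OF assms(3)]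
  show ?thesis
  proof (rule submodI)
    show "leading_coeffs D x J n \<subseteq> carrier R" using D(1) by (auto simp: leading_coeffs_def)
    have "\<zero> = \<zero> \<otimes> x [^] n \<oplus> \<zero>" using assms by simp
    then have "\<zero> \<otimes> x [^] n \<oplus> \<zero> \<in> J" using J(2) by simp
    then show "\<zero> \<in> leading_coeffs D x J n"
      using P(2) D(2) unfolding leading_coeffs_def by blast
  next
    fix u v assume "u \<in> leading_coeffs D x J n" "v \<in> leading_coeffs D x J n"
    then obtain y z where *: "u \<in> D" "v \<in> D" "y \<in> Span D (exp_base x n)" "z \<in> Span D (exp_base x n)"
      "u \<otimes> x [^] n \<oplus> y \<in> J" "v \<otimes> x [^] n \<oplus> z \<in> J" unfolding leading_coeffs_def by blast
    have c: "u \<in> carrier R" "v \<in> carrier R" "y \<in> carrier R" "z \<in> carrier R" "x [^] n \<in> carrier R"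
      using * D(1) P(1) assms by auto
    have "(u \<oplus> v) \<otimes> x [^] n \<oplus> (y \<oplus> z) = (u \<otimes> x [^] n \<oplus> y) \<oplus> (v \<otimes> x [^] n \<oplus> z)"
      using c by algebra
    then have "(u \<oplus> v) \<otimes> x [^] n \<oplus> (y \<oplus> z) \<in> J" using J(3)[OF *(5,6)] by simp
    then show "u \<oplus> v \<in> leading_coeffs D x J n"
      using * P(3) D(7) unfolding leading_coeffs_def by blast
  next
    fix d u assume "d \<in> D" "u \<in> leading_coeffs D x J n"
    then obtain y where *: "u \<in> D" "d \<in> D" "y \<in> Span D (exp_base x n)"
      "u \<otimes> x [^] n \<oplus> y \<in> J" unfolding leading_coeffs_def by blast
    have c: "u \<in> carrier R" "d \<in> carrier R" "y \<in> carrier R" "x [^] n \<in> carrier R"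
      using * D(1) P(1) assms by auto
    have "(d \<otimes> u) \<otimes> x [^] n \<oplus> (d \<otimes> y) = d \<otimes> (u \<otimes> x [^] n \<oplus> y)"
      using c by algebra
    then have "(d \<otimes> u) \<otimes> x [^] n \<oplus> (d \<otimes> y) \<in> J" using J(4)[OF *(2,4)] by simp
    then show "d \<otimes> u \<in> leading_coeffs D x J n"
      using * P(4) D(6) unfolding leading_coeffs_def by blast
  qed
qed

text \<open>Combining lifts of the generators with the same coefficients from \<open>D\<close> lifts
  any linear combination: the lower terms change but stay below degree \<open>n\<close>.\<close>

lemma leading_coeffs_lift:
  assumes "subring D R" "x \<in> carrier R" "submod D J" "set bs \<subseteq> leading_coeffs D x J n"
  shows "\<exists>fs. set fs \<subseteq> J \<and>
    (\<forall>a\<in>Span D bs. \<exists>g\<in>Span D fs. \<exists>y\<in>Span D (exp_base x n). g = a \<otimes> x [^] n \<oplus> y)"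
  using assms(4)
proof (induction bs)
  case Nil
  have "\<exists>g\<in>Span D []. \<exists>y\<in>Span D (exp_base x n). g = a \<otimes> x [^] n \<oplus> y" if "a \<in> Span D []" for a
    using that submodE(2)[OF submod_Span_exp[OF assms(1,2)]] assms(2)
    by (intro bexI[of _ "\<zero>"]) (auto simp: mem_Span_Nil)
  then show ?case by (intro exI[of _ "[]"]) simp
next
  case (Cons b bs)
  note D = subringE[OF assms(1)]
  note P = submodE[OF submod_Span_exp[OF assms(1,2), of n]]
  from Cons obtain fs where fs: "set fs \<subseteq> J"
    "\<And>a. a \<in> Span D bs \<Longrightarrow> \<exists>g\<in>Span D fs. \<exists>y\<in>Span D (exp_base x n). g = a \<otimes> x [^] n \<oplus> y" by auto
  from Cons.prems obtain y where y: "b \<in> D" "y \<in> Span D (exp_base x n)" "b \<otimes> x [^] n \<oplus> y \<in> J"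
    unfolding leading_coeffs_def by auto
  let ?f = "b \<otimes> x [^] n \<oplus> y"
  have fsc: "set fs \<subseteq> carrier R" using fs(1) submodE(1)[OF assms(3)] by blast
  have bsc: "set bs \<subseteq> carrier R" using Cons.prems D(1) unfolding leading_coeffs_def by auto
  have "\<exists>g\<in>Span D (?f # fs). \<exists>z\<in>Span D (exp_base x n). g = a \<otimes> x [^] n \<oplus> z"
    if "a \<in> Span D (b # bs)" for a
  proof -
    from that obtain d a' where a: "d \<in> D" "a' \<in> Span D bs" "a = d \<otimes> b \<oplus> a'"
      unfolding mem_Span_Cons by blast
    from fs(2)[OF a(2)] obtain g z where g: "g \<in> Span D fs" "z \<in> Span D (exp_base x n)"
      "g = a' \<otimes> x [^] n \<oplus> z" by blast
    have c: "d \<in> carrier R" "b \<in> carrier R" "y \<in> carrier R" "z \<in> carrier R" "x [^] n \<in> carrier R"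
      "a' \<in> carrier R"
      using a g y D(1) P(1) assms submodE(1)[OF submod_Span[OF assms(1) bsc]] by auto
    have "d \<otimes> ?f \<oplus> g = a \<otimes> x [^] n \<oplus> (d \<otimes> y \<oplus> z)"
      unfolding a(3) g(3) using c by algebra
    moreover have "d \<otimes> ?f \<oplus> g \<in> Span D (?f # fs)" using a g unfolding mem_Span_Cons by blast
    moreover have "d \<otimes> y \<oplus> z \<in> Span D (exp_base x n)" using P(3,4) a y g by blast
    ultimately show ?thesis by metis
  qed
  then show ?case using fs(1) y(3) by (intro exI[of _ "?f # fs"]) auto
qed

text \<open>The leading coefficients in degree \<open>n\<close> form an ideal of \<open>D\<close>
  that grows with \<open>n\<close>, since \<open>J\<close> is closed under multiplication by
  \<open>x\<close>. The chain is constant from some \<open>N\<close> on, and lifts of generators in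
  the degrees up to \<open>N\<close> generate \<open>J\<close>.\<close>

theorem noetherian_simple_extension:
  assumes "noetherian_subring D" "x \<in> carrier R"
  shows "noetherian_subring (simple_extension D x)"
proof -
  have sD: "subring D R" using assms(1) unfolding noetherian_subring_def by blast
  have noeth: "\<exists>bs. set bs \<subseteq> J \<and> J \<subseteq> Span D bs" if "submod D J" "J \<subseteq> D" for J
    using assms(1) that unfolding noetherian_subring_def by blast
  note D = subringE[OF sD]
  define E where "E = simple_extension D x"
  have sE: "subring E R" unfolding E_def using subring_simple_extension[OF sD assms(2)] .
  have DE: "D \<subseteq> E" unfolding E_def using simple_extension_incl[OF D(1) assms(2)] .
  have xE: "x \<in> E" unfolding E_def using simple_extension_mem[OF sD assms(2)] .
  have xkE: "x [^] (k::nat) \<in> E" for k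
    using subringE(3,6)[OF sE] xE by (induction k) auto
  have "\<exists>fs. set fs \<subseteq> J \<and> J \<subseteq> Span E fs" if J: "submod E J" "J \<subseteq> E" for J
  proof -
    have JD: "submod D J" using submod_mono[OF J(1) DE] .
    note Jc = submodE[OF J(1)]
    define L where "L = leading_coeffs D x J"
    have L: "submod D (L n)" "L n \<subseteq> D" for n
      unfolding L_def using submod_leading_coeffs[OF sD assms(2) JD] by (auto simp: leading_coeffs_def)
    have step: "L n \<subseteq> L (Suc n)" for n
    proof
      fix a assume "a \<in> L n"
      then obtain y where y: "a \<in> D" "y \<in> Span D (exp_base x n)" "a \<otimes> x [^] n \<oplus> y \<in> J"
        unfolding L_def leading_coeffs_def by blast
      have c: "a \<in> carrier R" "y \<in> carrier R" "x [^] n \<in> carrier R"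
        using y D(1) submodE(1)[OF submod_Span_exp[OF sD assms(2)]] assms(2) by auto
      have "x \<otimes> (a \<otimes> x [^] n \<oplus> y) \<in> J" using Jc(4) xE y by blast
      moreover have "x \<otimes> (a \<otimes> x [^] n \<oplus> y) = a \<otimes> (x [^] n \<otimes> x) \<oplus> x \<otimes> y"
        using c assms(2) by algebra
      moreover have "x \<otimes> y \<in> Span D (exp_base x (Suc n))"
        using Span_exp_shift[OF sD assms(2) y(2), of 1] assms(2) by simp
      ultimately have "a \<otimes> x [^] Suc n \<oplus> x \<otimes> y \<in> J" by simp
      then show "a \<in> L (Suc n)"
        using y(1) \<open>x \<otimes> y \<in> _\<close> unfolding L_def leading_coeffs_def by blast
    qed
    have mono: "m \<le> n \<Longrightarrow> L m \<subseteq> L n" for m n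
      using step by (rule lift_Suc_mono_le)
    have "submod D (\<Union>n. L n)"
    proof (rule submodI)
      fix u v assume "u \<in> (\<Union>n. L n)" "v \<in> (\<Union>n. L n)"
      then obtain m n where "u \<in> L m" "v \<in> L n" by blast
      then have "u \<in> L (max m n)" "v \<in> L (max m n)"
        using mono[of m "max m n"] mono[of n "max m n"] by auto
      then show "u \<oplus> v \<in> (\<Union>n. L n)" using submodE(3)[OF L(1)] by blast
    next
      show "(\<Union>n. L n) \<subseteq> carrier R" using L(2) D(1) by blast
      show "\<zero> \<in> (\<Union>n. L n)" using submodE(2)[OF L(1)] by blast
      show "d \<otimes> u \<in> (\<Union>n. L n)" if "d \<in> D" "u \<in> (\<Union>n. L n)" for d u
        using submodE(4)[OF L(1)] that by blast
    qed
    from noeth[OF this] L(2) obtain bs where bs: "set bs \<subseteq> (\<Union>n. L n)" "(\<Union>n. L n) \<subseteq> Span D bs"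
      by blast
    \<comment> \<open>The finitely many generators of the union occur together at one stage, where
      the chain stops.\<close>
    have "\<exists>N. set bs \<subseteq> L N" using bs(1)
    proof (induction bs)
      case (Cons b bs)
      then obtain m n where "b \<in> L m" "set bs \<subseteq> L n" by auto
      then have "set (b # bs) \<subseteq> L (max m n)"
        using mono[of m "max m n"] mono[of n "max m n"] by auto
      then show ?case by blast
    qed simp
    then obtain N where N: "set bs \<subseteq> L N" by blast
    then have LN: "L n \<subseteq> L N" for n using bs(2) Span_least[OF L(1) N] by blast
    have "\<exists>fs. set fs \<subseteq> J \<and>
      (\<forall>a\<in>L i. \<exists>g\<in>Span D fs. \<exists>y\<in>Span D (exp_base x i). g = a \<otimes> x [^] i \<oplus> y)" for i
    proof -
      from noeth[OF L] obtain cs where cs: "set cs \<subseteq> L i" "L i \<subseteq> Span D cs" by blast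
      from leading_coeffs_lift[OF sD assms(2) JD cs(1)[unfolded L_def]] cs(2)
      show ?thesis by blast
    qed
    then obtain F where F: "\<And>i. set (F i) \<subseteq> J"
      "\<And>i a. a \<in> L i \<Longrightarrow> \<exists>g\<in>Span D (F i). \<exists>y\<in>Span D (exp_base x i). g = a \<otimes> x [^] i \<oplus> y"
      by metis
    define fs where "fs = concat (map F [0..<Suc N])"
    have fsJ: "set fs \<subseteq> J" unfolding fs_def using F(1) by auto
    have fsc: "set fs \<subseteq> carrier R" using fsJ Jc(1) by blast
    note S = submodE[OF submod_Span[OF sE fsc]]
    have SJ: "Span E fs \<subseteq> J" using Span_least[OF J(1) fsJ] .
    have low: "\<exists>g\<in>Span E fs. \<exists>y\<in>Span D (exp_base x i). g = a \<otimes> x [^] i \<oplus> y"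
      if "a \<in> L i" "i \<le> N" for a i
    proof -
      have "i \<in> set [0..<Suc N]" using that(2) by auto
      then have "set (F i) \<subseteq> set fs" unfolding fs_def set_concat set_map by blast
      then have "Span D (F i) \<subseteq> Span E fs"
        using Span_mono[OF sD fsc] Span_base_mono[OF DE sE fsc] by blast
      then show ?thesis using F(2)[OF that(1)] by blast
    qed
    \<comment> \<open>Above degree \<open>N\<close>, a lift of the same coefficient in degree
      \<open>N\<close> is shifted by a power of \<open>x\<close>. The span of \<open>fs\<close> is
      over \<open>E\<close>, which contains that power; the lower terms remain in a span over
      \<open>D\<close>.\<close>
    have key: "\<exists>g\<in>Span E fs. \<exists>y\<in>Span D (exp_base x n). g = a \<otimes> x [^] n \<oplus> y" if a: "a \<in> L n" for a n
    proof (cases "n \<le> N")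
      case False
      then obtain k where k: "n = k + N" by (metis le_add_diff_inverse2 nat_le_linear)
      from low[of a N] a LN obtain g y where g: "g \<in> Span E fs" "y \<in> Span D (exp_base x N)"
        "g = a \<otimes> x [^] N \<oplus> y" by blast
      have c: "a \<in> carrier R" "y \<in> carrier R" "x [^] N \<in> carrier R" "x [^] k \<in> carrier R"
        using subsetD[OF D(1) subsetD[OF L(2) a]]
          subsetD[OF submodE(1)[OF submod_Span_exp[OF sD assms(2)]] g(2)] assms(2) by auto
      have "x [^] k \<otimes> g = a \<otimes> (x [^] k \<otimes> x [^] N) \<oplus> x [^] k \<otimes> y"
        unfolding g(3) using c by algebra
      then have "x [^] k \<otimes> g = a \<otimes> x [^] n \<oplus> x [^] k \<otimes> y"
        using assms(2) by (simp add: k nat_pow_mult)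
      moreover have "x [^] k \<otimes> g \<in> Span E fs" using S(4) xkE g by blast
      moreover have "x [^] k \<otimes> y \<in> Span D (exp_base x n)"
        using Span_exp_shift[OF sD assms(2) g(2)] k by simp
      ultimately show ?thesis by blast
    qed (use low a in blast)
    \<comment> \<open>Subtracting an element of \<open>Span E fs\<close> with the same leading
      coefficient stays in \<open>J\<close> and lowers the degree.\<close>
    have "J \<inter> Span D (exp_base x n) \<subseteq> Span E fs" for n
    proof (induction n)
      case 0
      then show ?case using S(2) by (auto simp: exp_base_0 mem_Span_Nil)
    next
      case (Suc n)
      show ?case
      proof
        note P = submod_Span_exp[OF sD assms(2), of n]
        fix f assume "f \<in> J \<inter> Span D (exp_base x (Suc n))"
        then obtain a y where f: "f \<in> J" "a \<in> D" "y \<in> Span D (exp_base x n)" "f = a \<otimes> x [^] n \<oplus> y"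
          unfolding exp_base_Suc Int_iff mem_Span_Cons by blast
        then have "a \<in> L n" unfolding L_def leading_coeffs_def by blast
        from key[OF this] obtain g z where g: "g \<in> Span E fs" "z \<in> Span D (exp_base x n)"
          "g = a \<otimes> x [^] n \<oplus> z" by blast
        have c: "a \<in> carrier R" "y \<in> carrier R" "z \<in> carrier R" "x [^] n \<in> carrier R"
          using f g D(1) submodE(1)[OF P] assms(2) by auto
        have "f \<ominus> g = y \<ominus> z" unfolding f(4) g(3) using c by algebra
        then have "f \<ominus> g \<in> Span D (exp_base x n)" using submod_diff[OF sD P f(3) g(2)] by simp
        moreover have "f \<ominus> g \<in> J" using submod_diff[OF sE J(1) f(1)] g(1) SJ by blast
        ultimately have "f \<ominus> g \<in> Span E fs" using Suc by blast
        then have "(f \<ominus> g) \<oplus> g \<in> Span E fs" using S(3) g(1) by blast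
        moreover have "(f \<ominus> g) \<oplus> g = f" unfolding f(4) g(3) using c by algebra
        ultimately show "f \<in> Span E fs" by simp
      qed
    qed
    then have "J \<subseteq> Span E fs"
      using J(2) simple_extension_eq_Span[OF sD assms(2)] unfolding E_def by blast
    then show ?thesis using fsJ by blast
  qed
  then show ?thesis using sE unfolding noetherian_subring_def E_def by blast
qed

corollary noetherian_finite_extension:
  "noetherian_subring D \<Longrightarrow> set xs \<subseteq> carrier R \<Longrightarrow> noetherian_subring (finite_extension D xs)"
  by (induction xs) (auto intro: noetherian_simple_extension)

end

section \<open>Nakayama's lemma and Zariski's lemma\<close>

text \<open>\<open>D\<close> need not be a field, so the leading coefficient cannot be normalized.
  In a domain, allowing any nonzero one means being algebraic over the fraction field of
  \<open>D\<close>.\<close>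

definition (in ring) algebraic_elem :: "'a set \<Rightarrow> 'a \<Rightarrow> bool" where
  "algebraic_elem D x \<longleftrightarrow> (\<exists>a\<in>D - {\<zero>}. algebraic_at D a x)"

context cring
begin

lemma Span_singletonI:
  assumes "d \<in> D" "y = d \<otimes> b \<oplus> \<zero>"
  shows "y \<in> Span D [b]"
  unfolding mem_Span_Cons by (rule bexI[OF _ assms(1)], rule bexI[of _ \<zero>]) (simp_all add: assms(2) mem_Span_Nil)

text \<open>In the application \<open>V\<close> consists of the elements of \<open>D\<close> congruent to a power of \<open>a\<close> modulo \<open>u\<close>, which
  stands in for localizing at \<open>a\<close>.\<close>

lemma nakayama:
  assumes "subring D R" "u \<in> D" "V \<subseteq> D" "V \<noteq> {}" "\<And>v w. v \<in> V \<Longrightarrow> w \<in> V \<Longrightarrow> v \<otimes> w \<in> V"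
    "\<And>v e. v \<in> V \<Longrightarrow> e \<in> D \<Longrightarrow> v \<ominus> u \<otimes> e \<in> V"
    "set bs \<subseteq> carrier R" "\<And>b. b \<in> set bs \<Longrightarrow> \<exists>v\<in>V. \<exists>s\<in>Span D bs. v \<otimes> b = u \<otimes> s"
  shows "\<exists>w\<in>V. \<forall>b\<in>set bs. w \<otimes> b = \<zero>"
  using assms(7,8)
\<comment> \<open>The generators are eliminated one at a time, in place of the determinant of the
  system.\<close>
proof (induction bs)
  case Nil
  then show ?case using assms(4) by auto
next
  case (Cons b bs)
  note D = subringE[OF assms(1)]
  have bsc: "set bs \<subseteq> carrier R" "b \<in> carrier R" using Cons.prems by auto
  note S = submodE[OF submod_Span[OF assms(1) bsc(1)]]
  have u: "u \<in> carrier R" using assms(2) D(1) by blast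
  obtain v s' where "v \<in> V" "s' \<in> Span D (b # bs)" "v \<otimes> b = u \<otimes> s'"
    using Cons.prems(2)[of b] by auto
  then obtain e s where v: "v \<in> V" "e \<in> D" "s \<in> Span D bs" "v \<otimes> b = u \<otimes> (e \<otimes> b \<oplus> s)"
    unfolding mem_Span_Cons by blast
  \<comment> \<open>Moving the multiple of \<open>b\<close> to the left expresses
    \<open>v' \<otimes> b\<close> by the remaining generators.\<close>
  define v' where "v' = v \<ominus> u \<otimes> e"
  have v': "v' \<in> V" unfolding v'_def using assms(6) v by blast
  have c: "v \<in> carrier R" "e \<in> carrier R" "s \<in> carrier R" "v' \<in> carrier R"
    using v v' assms(3) D(1) S(1) by auto
  have "v' \<otimes> b = v \<otimes> b \<ominus> u \<otimes> e \<otimes> b" unfolding v'_def using c u bsc by algebra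
  also have "\<dots> = u \<otimes> s" unfolding v(4) using c u bsc by algebra
  finally have v'b: "v' \<otimes> b = u \<otimes> s" .
  have "\<exists>w\<in>V. \<exists>r\<in>Span D bs. w \<otimes> d = u \<otimes> r" if d: "d \<in> set bs" for d
  proof -
    have dc: "d \<in> carrier R" using d bsc by blast
    obtain w r' where "w \<in> V" "r' \<in> Span D (b # bs)" "w \<otimes> d = u \<otimes> r'"
      using Cons.prems(2)[of d] d by auto
    then obtain f r where w: "w \<in> V" "f \<in> D" "r \<in> Span D bs" "w \<otimes> d = u \<otimes> (f \<otimes> b \<oplus> r)"
      unfolding mem_Span_Cons by blast
    have wc: "w \<in> carrier R" "f \<in> carrier R" "r \<in> carrier R" using w assms(3) D(1) S(1) by auto
    \<comment> \<open>Multiplication by \<open>v'\<close> makes \<open>b\<close> replaceable in the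
      relation for \<open>d\<close>. What remains is a relation of the required shape among
      \<open>bs\<close> alone.\<close>
    have "(v' \<otimes> w) \<otimes> d = v' \<otimes> (w \<otimes> d)" using c wc dc by algebra
    also have "\<dots> = u \<otimes> (f \<otimes> (v' \<otimes> b) \<oplus> v' \<otimes> r)" unfolding w(4) using c wc dc bsc u by algebra
    finally have "(v' \<otimes> w) \<otimes> d = u \<otimes> (f \<otimes> (u \<otimes> s) \<oplus> v' \<otimes> r)" unfolding v'b .
    moreover have "f \<otimes> (u \<otimes> s) \<oplus> v' \<otimes> r \<in> Span D bs"
      using S(3,4) w v v' assms(2,3) by (meson subsetD)
    ultimately show ?thesis using assms(5)[OF v' w(1)] by blast
  qed
  then obtain w where w: "w \<in> V" "\<And>d. d \<in> set bs \<Longrightarrow> w \<otimes> d = \<zero>"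
    using Cons.IH[OF bsc(1)] by blast
  have wc: "w \<in> carrier R" using w assms(3) D(1) by blast
  have z: "submod D {\<zero>}" using D(1) by (auto intro!: submodI)
  \<comment> \<open>\<open>w\<close> kills the remaining generators, hence also \<open>s\<close>;
    therefore \<open>w \<otimes> v'\<close> kills \<open>b\<close> as well.\<close>
  have "Span D bs \<subseteq> {y \<in> carrier R. w \<otimes> y \<in> {\<zero>}}"
    using w(2) bsc wc by (intro Span_least submod_preimage_mult z D(1)) auto
  then have ws: "w \<otimes> s = \<zero>" using v(3) by blast
  have "(w \<otimes> v') \<otimes> d = \<zero>" if "d \<in> set (b # bs)" for d
  proof (cases "d = b")
    case True
    have "(w \<otimes> v') \<otimes> b = w \<otimes> (v' \<otimes> b)" using wc c bsc by algebra
    also have "\<dots> = u \<otimes> (w \<otimes> s)" unfolding v'b using wc c u by algebra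
    finally show ?thesis using True ws u by simp
  next
    case False
    then have d: "d \<in> set bs" "d \<in> carrier R" using that bsc by auto
    have "(w \<otimes> v') \<otimes> d = v' \<otimes> (w \<otimes> d)" using wc c d(2) by algebra
    then show ?thesis using w(2)[OF d(1)] c by simp
  qed
  then show ?case using assms(5)[OF w(1) v'] by blast
qed

section \<open>Finite generation up to powers of a denominator\<close>

lemma Span_mult:
  assumes "subring D R" "set bs \<subseteq> carrier R" "set cs \<subseteq> carrier R"
    "y \<in> Span D bs" "z \<in> Span D cs"
  shows "y \<otimes> z \<in> Span D [b \<otimes> c. b \<leftarrow> bs, c \<leftarrow> cs]"
proof -
  note D = subringE[OF assms(1)]
  let ?ps = "[b \<otimes> c. b \<leftarrow> bs, c \<leftarrow> cs]"
  have ps: "set ?ps \<subseteq> carrier R" using assms(2,3) by auto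
  note M = submod_Span[OF assms(1) ps]
  have z: "z \<in> carrier R" using assms submodE(1)[OF submod_Span] by blast
  have "z \<otimes> b \<in> Span D ?ps" if b: "b \<in> set bs" for b
  proof -
    have "b \<otimes> c \<in> Span D ?ps" if "c \<in> set cs" for c
      using b that by (intro subsetD[OF set_subset_Span[OF assms(1) ps]]) auto
    then have "Span D cs \<subseteq> {y \<in> carrier R. b \<otimes> y \<in> Span D ?ps}"
      using assms b by (intro Span_least submod_preimage_mult M D(1)) auto
    then have "b \<otimes> z \<in> Span D ?ps" using assms(5) by blast
    then show ?thesis using b assms(2) z m_comm by (metis subsetD)
  qed
  then have "Span D bs \<subseteq> {y \<in> carrier R. z \<otimes> y \<in> Span D ?ps}"
    using assms z by (intro Span_least submod_preimage_mult M D(1)) auto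
  then have "y \<in> carrier R" "z \<otimes> y \<in> Span D ?ps" using assms(4) by blast+
  then show ?thesis using z m_comm by metis
qed

text \<open>Each further factor \<open>x\<close> produces at most one term in \<open>x ^ n\<close>,
  and one more factor \<open>a\<close> rewrites it by lower powers.\<close>

lemma algebraic_at_powers:
  assumes "subring D R" "x \<in> carrier R" "a \<in> D" "a \<otimes> x [^] n \<in> Span D (exp_base x n)"
  shows "\<exists>m::nat. a [^] m \<otimes> x [^] (i::nat) \<in> Span D (exp_base x n)"
proof (induction i)
  case 0
  show ?case
  proof (cases n)
    case 0
    \<comment> \<open>For \<open>n = 0\<close> the hypothesis says \<open>a = \<zero>\<close>, so
      the exponent 1 works, while the exponent 0 would claim
      \<open>\<one> = \<zero>\<close>.\<close>
    then show ?thesis using assms by (intro exI[of _ 1]) (use subringE(1)[OF assms(1)] in auto)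
  next
    case (Suc k)
    then have "x [^] (0::nat) \<in> Span D (exp_base x n)" using pow_in_Span_exp[OF assms(1,2)] by blast
    then show ?thesis by (intro exI[of _ 0]) simp
  qed
next
  case (Suc i)
  note P = submodE[OF submod_Span_exp[OF assms(1,2), of n]]
  have a: "a \<in> carrier R" using assms(3) subringE(1)[OF assms(1)] by blast
  from Suc obtain m :: nat where m: "a [^] m \<otimes> x [^] i \<in> Span D (exp_base x n)" by blast
  have "x \<otimes> (a [^] m \<otimes> x [^] i) \<in> Span D (exp_base x (Suc n))"
    using Span_exp_shift[OF assms(1,2) m, of 1] assms(2) by simp
  then obtain d v where d: "d \<in> D" "v \<in> Span D (exp_base x n)"
    "x \<otimes> (a [^] m \<otimes> x [^] i) = d \<otimes> x [^] n \<oplus> v" unfolding exp_base_Suc mem_Span_Cons by blast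
  have c: "d \<in> carrier R" "v \<in> carrier R" "x [^] n \<in> carrier R" "a [^] m \<in> carrier R" "x [^] i \<in> carrier R"
    using d P(1) subringE(1)[OF assms(1)] a assms(2) by auto
  have "a [^] Suc m \<otimes> x [^] Suc i = a \<otimes> (x \<otimes> (a [^] m \<otimes> x [^] i))"
    unfolding nat_pow_Suc using c a assms(2) by algebra
  also have "\<dots> = d \<otimes> (a \<otimes> x [^] n) \<oplus> a \<otimes> v" unfolding d(3) using c a by algebra
  finally have "a [^] Suc m \<otimes> x [^] Suc i \<in> Span D (exp_base x n)"
    using P(3,4) assms(3,4) d by simp
  then show ?case by blast
qed

text \<open>This is the finiteness of \<open>D[xs, 1/a]\<close> over \<open>D[1/a]\<close> with
  denominators cleared: one list of generators serves all \<open>f\<close>, and only the exponent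
  depends on \<open>f\<close>. Adjoining \<open>x\<close> multiplies the old generators by the
  powers of \<open>x\<close> below the degree of its equation.\<close>

lemma finite_extension_fg_upto_powers:
  assumes "subring D R" "a \<in> D" "set xs \<subseteq> carrier R" "\<And>x. x \<in> set xs \<Longrightarrow> algebraic_at D a x"
  shows "\<exists>bs. set bs \<subseteq> carrier R \<and> (\<forall>f\<in>finite_extension D xs. \<exists>m::nat. a [^] m \<otimes> f \<in> Span D bs)"
  using assms(3,4)
proof (induction xs)
  case Nil
  note D = subringE[OF assms(1)]
  have "f \<in> Span D [\<one>]" if "f \<in> D" for f
    using that D(1) by (intro Span_singletonI[of f]) auto
  moreover have "a [^] (0::nat) \<otimes> f = f" if "f \<in> D" for f using that D(1) by auto
  ultimately have "\<forall>f\<in>finite_extension D []. a [^] (0::nat) \<otimes> f \<in> Span D [\<one>]" by simp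
  then show ?case by (intro exI[of _ "[\<one>]"] conjI ballI exI[of _ 0]) auto
next
  case (Cons x xs)
  note D = subringE[OF assms(1)]
  define E where "E = finite_extension D xs"
  have x: "x \<in> carrier R" and xs: "set xs \<subseteq> carrier R" using Cons.prems by auto
  have E: "subring E R" unfolding E_def using subring_finite_extension[OF assms(1) xs] .
  from Cons obtain bs where bs: "set bs \<subseteq> carrier R"
    "\<And>f. f \<in> E \<Longrightarrow> \<exists>m::nat. a [^] m \<otimes> f \<in> Span D bs" unfolding E_def by auto
  from Cons.prems obtain n where n: "a \<otimes> x [^] n \<in> Span D (exp_base x n)"
    unfolding algebraic_at_def by auto
  have a: "a \<in> carrier R" using assms(2) D(1) by blast
  have aD: "a [^] (m::nat) \<in> D" for m using D(3,6) assms(2) by (induction m) auto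
  define cs where "cs = [b \<otimes> c. b \<leftarrow> bs, c \<leftarrow> exp_base x n]"
  have cs: "set cs \<subseteq> carrier R" unfolding cs_def using bs(1) exp_base_in_carrier[OF x, of n] by auto
  note S = submodE[OF submod_Span[OF assms(1) cs]]
  have "\<exists>m::nat. a [^] m \<otimes> f \<in> Span D cs" if "f \<in> Span E (exp_base x N)" for f N
    using that
  proof (induction N arbitrary: f)
    case 0
    then have "a [^] (0::nat) \<otimes> f = \<zero>" by (simp add: exp_base_0 mem_Span_Nil)
    then show ?case using S(2) by metis
  next
    case (Suc N)
    then obtain g f' where f: "g \<in> E" "f' \<in> Span E (exp_base x N)" "f = g \<otimes> x [^] N \<oplus> f'"
      unfolding exp_base_Suc mem_Span_Cons by blast
    obtain i :: nat where i: "a [^] i \<otimes> g \<in> Span D bs" using bs(2) f(1) by blast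
    obtain j :: nat where j: "a [^] j \<otimes> x [^] N \<in> Span D (exp_base x n)"
      using algebraic_at_powers[OF assms(1) x assms(2) n] by blast
    obtain k :: nat where k: "a [^] k \<otimes> f' \<in> Span D cs" using Suc.IH[OF f(2)] by blast
    have c: "g \<in> carrier R" "f' \<in> carrier R" "x [^] N \<in> carrier R"
      "a [^] i \<in> carrier R" "a [^] j \<in> carrier R" "a [^] k \<in> carrier R"
      using f subringE(1)[OF E] submodE(1)[OF submod_Span_exp[OF E x]] x a by auto
    have p: "(a [^] i \<otimes> g) \<otimes> (a [^] j \<otimes> x [^] N) \<in> Span D cs"
      unfolding cs_def using Span_mult[OF assms(1) bs(1) exp_base_in_carrier[OF x] i j] .
    have "a [^] (i + j + k) \<otimes> f = (a [^] i \<otimes> a [^] j \<otimes> a [^] k) \<otimes> f"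
      using a by (simp add: nat_pow_mult)
    also have "\<dots> = a [^] k \<otimes> ((a [^] i \<otimes> g) \<otimes> (a [^] j \<otimes> x [^] N)) \<oplus> (a [^] i \<otimes> a [^] j) \<otimes> (a [^] k \<otimes> f')"
      unfolding f(3) using c by algebra
    finally have "a [^] (i + j + k) \<otimes> f \<in> Span D cs"
      using S(3,4) p k aD D(6) by simp
    then show ?case by blast
  qed
  then have "\<forall>f\<in>finite_extension D (x # xs). \<exists>m::nat. a [^] m \<otimes> f \<in> Span D cs"
    using simple_extension_eq_Span[OF E x] unfolding E_def by auto
  then show ?case using cs by blast
qed

lemma algebraic_at_smult:
  assumes "subring D R" "x \<in> carrier R" "c \<in> D" "d \<in> D" "algebraic_at D c x"
  shows "algebraic_at D (d \<otimes> c) x"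
proof -
  from assms(5) obtain n where n: "c \<otimes> x [^] n \<in> Span D (exp_base x n)" unfolding algebraic_at_def by blast
  have "d \<otimes> (c \<otimes> x [^] n) \<in> Span D (exp_base x n)"
    using submodE(4)[OF submod_Span_exp[OF assms(1,2)] assms(4) n] .
  moreover have "d \<otimes> (c \<otimes> x [^] n) = d \<otimes> c \<otimes> x [^] n"
    using assms subringE(1)[OF assms(1)] by (simp add: m_assoc subset_iff)
  ultimately show ?thesis unfolding algebraic_at_def by auto
qed

lemma algebraic_elem_mono:
  assumes "D \<subseteq> E" "subring E R" "x \<in> carrier R" "algebraic_elem D x"
  shows "algebraic_elem E x"
  using assms Span_base_mono[OF assms(1,2) exp_base_in_carrier[OF assms(3)]]
  unfolding algebraic_elem_def algebraic_at_def by blast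

text \<open>Zero top coefficients are stripped. Neither \<open>m\<close> nor \<open>c\<close> is
  unique unless \<open>x\<close> is transcendental, so this chooses a representation rather than
  determining a degree.\<close>

lemma leading_term:
  assumes "y \<in> Span D (exp_base x n)" "y \<noteq> \<zero>" "subring D R" "x \<in> carrier R"
  shows "\<exists>m. \<exists>c\<in>D - {\<zero>}. \<exists>z\<in>Span D (exp_base x m). y = c \<otimes> x [^] m \<oplus> z"
  using assms(1)
proof (induction n)
  case 0
  then show ?case using assms(2) by (simp add: exp_base_0 mem_Span_Nil)
next
  case (Suc n)
  then obtain c z where c: "c \<in> D" "z \<in> Span D (exp_base x n)" "y = c \<otimes> x [^] n \<oplus> z"
    unfolding exp_base_Suc mem_Span_Cons by blast
  show ?case
  proof (cases "c = \<zero>")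
    case True
    have "z \<in> carrier R" using c(2) submodE(1)[OF submod_Span_exp[OF assms(3,4)]] by blast
    then have "y = z" using c True assms(4) by simp
    then show ?thesis using Suc.IH c(2) by blast
  qed (use c in blast)
qed

end

section \<open>Algebraic dependence over a subring of a domain\<close>

context domain
begin

lemma algebraic_elem_self:
  assumes "subring D R" "x \<in> D"
  shows "algebraic_elem D x"
proof -
  note D = subringE[OF assms(1)]
  have x: "x \<in> carrier R" using assms D(1) by blast
  have "\<one> \<otimes> x [^] (1::nat) = x \<otimes> x [^] (0::nat) \<oplus> \<zero>" using x by simp
  then have "\<one> \<otimes> x [^] (1::nat) \<in> Span D (exp_base x 1)"
    unfolding One_nat_def exp_base_Suc exp_base_0 by (rule Span_singletonI[OF assms(2)])
  then show ?thesis using D(3) one_not_zero unfolding algebraic_elem_def algebraic_at_def by blast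
qed

lemma algebraic_elem_common:
  assumes "subring D R" "set xs \<subseteq> carrier R" "\<And>x. x \<in> set xs \<Longrightarrow> algebraic_elem D x"
  shows "\<exists>a\<in>D - {\<zero>}. \<forall>x\<in>set xs. algebraic_at D a x"
  using assms(2,3)
proof (induction xs)
  case Nil
  then show ?case using subringE(3)[OF assms(1)] one_not_zero by auto
next
  case (Cons x xs)
  then obtain a where a: "a \<in> D - {\<zero>}" "\<And>y. y \<in> set xs \<Longrightarrow> algebraic_at D a y" by auto
  obtain b where b: "b \<in> D - {\<zero>}" "algebraic_at D b x"
    using Cons.prems unfolding algebraic_elem_def by auto
  note D = subringE[OF assms(1)]
  have c: "a \<in> carrier R" "b \<in> carrier R" using a b D(1) by auto
  have "a \<otimes> b \<in> D - {\<zero>}" using a b c D(6) integral by blast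
  moreover have "algebraic_at D (a \<otimes> b) x"
    using algebraic_at_smult[OF assms(1)] a b Cons.prems by simp
  moreover have "algebraic_at D (a \<otimes> b) y" if "y \<in> set xs" for y
    using algebraic_at_smult[OF assms(1), of y a b] a b that Cons.prems c m_comm[of b a] by auto
  ultimately show ?case by auto
qed

text \<open>Degrees in \<open>t\<close> belong to chosen representations only. Instead of
  contradicting transcendence by a degree count, the proof turns the mismatch of degrees into an
  equation for \<open>t\<close>.\<close>

lemma algebraic_if_divides_powers:
  assumes "subring D R" "t \<in> carrier R" "a \<in> simple_extension D t" "a \<noteq> \<zero>"
    "\<And>u. u \<in> simple_extension D t \<Longrightarrow> u \<noteq> \<zero> \<Longrightarrow>
       \<exists>m::nat. \<exists>e\<in>simple_extension D t. a [^] m = u \<otimes> e"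
  shows "algebraic_elem D t"
proof -
  note D = subringE[OF assms(1)]
  let ?P = "\<lambda>n. Span D (exp_base t n)"
  note P = submodE[OF submod_Span_exp[OF assms(1,2)]]
  define E where "E = simple_extension D t"
  have Eeq: "E = (\<Union>n. ?P n)" unfolding E_def using simple_extension_eq_Span[OF assms(1,2)] .
  have sE: "subring E R" unfolding E_def using subring_simple_extension[OF assms(1,2)] .
  note E = subringE[OF sE]
  have tE: "t \<in> E" unfolding E_def using simple_extension_mem[OF assms(1,2)] .
  have aE: "a \<in> E" using assms(3) E_def by simp
  have a: "a \<in> carrier R" using aE E(1) by blast
  have one: "\<one> \<in> ?P n" if "n > 0" for n
    using pow_in_Span_exp[OF assms(1,2) that] by simp
  obtain n c z where nc: "c \<in> D" "c \<noteq> \<zero>" "z \<in> ?P n" "a = c \<otimes> t [^] n \<oplus> z"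
    using leading_term[OF _ assms(4,1,2)] aE unfolding Eeq by blast
  define u where "u = \<one> \<oplus> t \<otimes> a"
  define y where "y = \<one> \<oplus> t \<otimes> z"
  have cc: "c \<in> carrier R" "z \<in> carrier R" "t [^] n \<in> carrier R" "t [^] Suc n \<in> carrier R"
    using nc D(1) P(1) assms(2) by (auto simp del: nat_pow_Suc)
  have tz: "t \<otimes> z \<in> ?P (Suc n)"
    using Span_exp_shift[OF assms(1,2) nc(3), of 1] assms(2) by simp
  have y: "y \<in> ?P (Suc n)" unfolding y_def by (rule P(3)[OF one tz]) simp
  then have yc: "y \<in> carrier R" using P(1) by blast
  have "u = c \<otimes> (t [^] n \<otimes> t) \<oplus> y" unfolding u_def y_def nc(4) using cc assms(2) by algebra
  then have u: "u = c \<otimes> t [^] Suc n \<oplus> y" by simp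
  have uE: "u \<in> E" unfolding u_def by (rule E(7)[OF E(3) E(6)[OF tE aE]])
  have uc: "u \<in> carrier R" using uE E(1) by blast
  show ?thesis
  proof (cases "u = \<zero>")
    \<comment> \<open>\<open>u = \<zero>\<close> is itself an equation for \<open>t\<close>, with
      leading coefficient \<open>c\<close>.\<close>
    case True
    have "c \<otimes> t [^] Suc n = u \<oplus> (\<ominus> y)" unfolding u using cc yc by algebra
    then have "c \<otimes> t [^] Suc n = \<ominus> y" unfolding True using yc by simp
    moreover have "\<ominus> y \<in> ?P (Suc n)" using submod_minus[OF assms(1) submod_Span_exp[OF assms(1,2)] y] .
    ultimately have "c \<otimes> t [^] Suc n \<in> ?P (Suc n)" by simp
    then show ?thesis using nc(1,2) unfolding algebraic_elem_def algebraic_at_def by blast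
  next
    case False
    then obtain m :: nat and e where me: "e \<in> E" "a [^] m = u \<otimes> e"
      using assms(5) uE unfolding E_def by blast
    \<comment> \<open>Since \<open>1 = u - t a\<close>, one has
      \<open>a ^ m = a ^ m u - t a ^ (m + 1)\<close>; so if \<open>u\<close> divides
      \<open>a ^ (m + 1)\<close>, it divides \<open>a ^ m\<close>. Descending to the exponent 0
      makes \<open>u\<close> a unit of \<open>E\<close>.\<close>
    have "\<exists>e\<in>E. \<one> = u \<otimes> e" using me
    proof (induction m arbitrary: e)
      case 0
      then show ?case by auto
    next
      case (Suc m)
      have c: "a [^] m \<in> carrier R" "e \<in> carrier R" using a Suc.prems E(1) by auto
      have aE': "a [^] m \<in> E" using aE E(3,6) by (induction m) auto
      have "a [^] m = a [^] m \<otimes> u \<ominus> t \<otimes> (a [^] m \<otimes> a)"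
        unfolding u_def using c a assms(2) by algebra
      also have "a [^] m \<otimes> a = u \<otimes> e" using Suc.prems by simp
      also have "a [^] m \<otimes> u \<ominus> t \<otimes> (u \<otimes> e) = u \<otimes> (a [^] m \<ominus> t \<otimes> e)"
        using c uc assms(2) by algebra
      finally have "a [^] m = u \<otimes> (a [^] m \<ominus> t \<otimes> e)" .
      moreover have "a [^] m \<ominus> t \<otimes> e \<in> E"
        unfolding a_minus_def using E(5,6,7) aE' tE Suc.prems(1) by simp
      ultimately show ?case using Suc.IH by simp
    qed
    then obtain e where e: "e \<in> E" "\<one> = u \<otimes> e" by blast
    then have "e \<noteq> \<zero>" using uc by auto
    then obtain m d w where md: "d \<in> D" "d \<noteq> \<zero>" "w \<in> ?P m" "e = d \<otimes> t [^] m \<oplus> w"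
      using leading_term[OF _ _ assms(1,2)] e(1) unfolding Eeq by blast
    \<comment> \<open>In the product of the representations of \<open>u\<close> and \<open>e\<close>
      every term but \<open>c d t ^ N\<close> stays below degree \<open>N\<close>. The product is
      \<open>1\<close>, which also lies below \<open>N\<close> as \<open>N > 0\<close>, and
      \<open>c d\<close> is nonzero in a domain.\<close>
    let ?N = "Suc n + m"
    have dc: "d \<in> carrier R" "w \<in> carrier R" "t [^] m \<in> carrier R"
      using md D(1) P(1) assms(2) by auto
    have "c \<otimes> (t [^] Suc n \<otimes> w) \<in> ?P ?N"
      by (rule P(4)[OF nc(1) Span_exp_shift[OF assms(1,2) md(3)]])
    moreover have "d \<otimes> (t [^] m \<otimes> y) \<in> ?P ?N"
      using P(4)[OF md(1) Span_exp_shift[OF assms(1,2) y, of m]] by (simp only: add.commute)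
    moreover have "y \<otimes> w \<in> ?P ?N"
      using Span_exp_mult[OF assms(1,2) y md(3)] .
    ultimately have rest: "c \<otimes> (t [^] Suc n \<otimes> w) \<oplus> d \<otimes> (t [^] m \<otimes> y) \<oplus> y \<otimes> w \<in> ?P ?N"
      (is "?r \<in> _") by (intro P(3))
    have rc: "?r \<in> carrier R" using rest P(1) by blast
    have "(c \<otimes> p \<oplus> y) \<otimes> (d \<otimes> q \<oplus> w) = c \<otimes> d \<otimes> (p \<otimes> q) \<oplus> (c \<otimes> (p \<otimes> w) \<oplus> d \<otimes> (q \<otimes> y) \<oplus> y \<otimes> w)"
      if "p \<in> carrier R" "q \<in> carrier R" for p q
      using cc(1) dc(1,2) yc that by algebra
    from this[OF cc(4) dc(3)] have "\<one> = c \<otimes> d \<otimes> t [^] ?N \<oplus> ?r"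
      unfolding e(2) u md(4) nat_pow_mult[OF assms(2)] .
    moreover have "v = (v \<oplus> r) \<ominus> r" if "v \<in> carrier R" "r \<in> carrier R" for v r
      using that by algebra
    ultimately have "c \<otimes> d \<otimes> t [^] ?N = \<one> \<ominus> ?r"
      using rc cc(1) dc(1) assms(2) by (metis m_closed nat_pow_closed)
    moreover have "\<one> \<ominus> ?r \<in> ?P ?N"
      using submod_diff[OF assms(1) submod_Span_exp[OF assms(1,2)] one rest] by simp
    ultimately have "algebraic_at D (c \<otimes> d) t" unfolding algebraic_at_def by metis
    moreover have "c \<otimes> d \<in> D - {\<zero>}" using nc md cc dc D(6)[of c d] integral[of c d] by auto
    ultimately show ?thesis unfolding algebraic_elem_def by blast
  qed
qed

text \<open>Adjoining elements one by one and keeping only those transcendental over the previous ones avoids the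
  transitivity of algebraic dependence.\<close>

lemma greedy_transcendence_basis:
  assumes "subring D R" "set xs \<subseteq> carrier R"
  shows "\<exists>ts. set ts \<subseteq> carrier R \<and> (\<forall>x\<in>set xs. algebraic_elem (finite_extension D ts) x) \<and>
    (\<forall>t ts'. ts = t # ts' \<longrightarrow> \<not> algebraic_elem (finite_extension D ts') t)"
  using assms(2)
proof (induction xs)
  case Nil
  then show ?case by (intro exI[of _ "[]"]) simp
next
  case (Cons x xs)
  then obtain ts where ts: "set ts \<subseteq> carrier R"
    "\<And>x. x \<in> set xs \<Longrightarrow> algebraic_elem (finite_extension D ts) x"
    "\<And>t ts'. ts = t # ts' \<Longrightarrow> \<not> algebraic_elem (finite_extension D ts') t" by auto
  have x: "x \<in> carrier R" and xs: "set xs \<subseteq> carrier R" using Cons.prems by auto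
  note s = subring_finite_extension[OF assms(1) ts(1)]
  show ?case
  proof (cases "algebraic_elem (finite_extension D ts) x")
    case True
    then show ?thesis using ts by (intro exI[of _ ts]) auto
  next
    case False
    have s': "subring (finite_extension D (x # ts)) R"
      using subring_finite_extension[OF assms(1), of "x # ts"] ts x by simp
    have "algebraic_elem (finite_extension D (x # ts)) y" if "y \<in> set xs" for y
      using algebraic_elem_mono[OF finite_extension_incl_aux[OF subringE(1)[OF assms(1)] x ts(1)] s' _ ts(2)[OF that]]
        that xs by blast
    moreover have "algebraic_elem (finite_extension D (x # ts)) x"
      using algebraic_elem_self[OF s'] simple_extension_mem[OF s x] by simp
    ultimately show ?thesis using False ts x by (intro exI[of _ "x # ts"]) auto
  qed
qed

end

section \<open>Fields that are finitely generated as rings over a subring\<close>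

context field
begin

text \<open>In a field \<open>u\<close> is invertible, so every generator is \<open>u\<close> times
  some element, which is what Nakayama's lemma asks for. The multiplier \<open>a ^ i + u e\<close>
  that it returns can kill the generators of a nonzero module only by being zero, and then
  \<open>u\<close> divides \<open>a ^ i\<close>.\<close>

lemma divides_power_if_algebraic:
  assumes "subring D R" "a \<in> D" "set xs \<subseteq> carrier R" "\<And>x. x \<in> set xs \<Longrightarrow> algebraic_at D a x"
    "finite_extension D xs = carrier R" "u \<in> D" "u \<noteq> \<zero>"
  shows "\<exists>m::nat. \<exists>e\<in>D. a [^] m = u \<otimes> e"
proof -
  note D = subringE[OF assms(1)]
  obtain bs where bs: "set bs \<subseteq> carrier R"
    "\<And>f. f \<in> carrier R \<Longrightarrow> \<exists>m::nat. a [^] m \<otimes> f \<in> Span D bs"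
    using finite_extension_fg_upto_powers[OF assms(1-4)] unfolding assms(5) by blast
  have a: "a \<in> carrier R" and u: "u \<in> carrier R" using assms D(1) by auto
  have aD: "a [^] (m::nat) \<in> D" for m using D(3,6) assms(2) by (induction m) auto
  define V where "V = {a [^] m \<oplus> u \<otimes> e |(m::nat) e. e \<in> D}"
  have VI: "v \<in> V" if "v = a [^] (m::nat) \<oplus> u \<otimes> e" "e \<in> D" for v m e
    using that unfolding V_def by blast
  have pV: "a [^] (m::nat) \<in> V" for m using a u D(2) by (intro VI[of _ m \<zero>]) auto
  have "\<exists>w\<in>V. \<forall>b\<in>set bs. w \<otimes> b = \<zero>"
  proof (rule nakayama[OF assms(1,6)])
    show "V \<subseteq> D" unfolding V_def using aD assms(6) D(6,7) by auto
    show "V \<noteq> {}" using pV by blast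
    show "v \<otimes> w \<in> V" if vw: "v \<in> V" "w \<in> V" for v w
    proof -
      obtain i j :: nat and e f where v: "e \<in> D" "f \<in> D" "v = a [^] i \<oplus> u \<otimes> e" "w = a [^] j \<oplus> u \<otimes> f"
        using vw unfolding V_def by blast
      have c: "e \<in> carrier R" "f \<in> carrier R" "a [^] i \<in> carrier R" "a [^] j \<in> carrier R"
        using v a D(1) by auto
      have "v \<otimes> w = a [^] i \<otimes> a [^] j \<oplus> u \<otimes> (a [^] i \<otimes> f \<oplus> e \<otimes> a [^] j \<oplus> u \<otimes> (e \<otimes> f))"
        unfolding v(3,4) using c u by algebra
      moreover have "a [^] i \<otimes> f \<oplus> e \<otimes> a [^] j \<oplus> u \<otimes> (e \<otimes> f) \<in> D"
        using aD v(1,2) assms(6) D(6,7) by simp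
      ultimately show ?thesis using a VI by (simp add: nat_pow_mult)
    qed
    show "v \<ominus> u \<otimes> e \<in> V" if ve: "v \<in> V" "e \<in> D" for v e
    proof -
      obtain i :: nat and f where v: "f \<in> D" "v = a [^] i \<oplus> u \<otimes> f" using ve unfolding V_def by blast
      have c: "e \<in> carrier R" "f \<in> carrier R" "a [^] i \<in> carrier R" using v ve a D(1) by auto
      have "v \<ominus> u \<otimes> e = a [^] i \<oplus> u \<otimes> (f \<ominus> e)" unfolding v(2) using c u by algebra
      moreover have "f \<ominus> e \<in> D" using v(1) ve(2) D(5,7) by (simp add: a_minus_def)
      ultimately show ?thesis by (rule VI)
    qed
    show "set bs \<subseteq> carrier R" using bs(1) .
    show "\<exists>v\<in>V. \<exists>s\<in>Span D bs. v \<otimes> b = u \<otimes> s" if "b \<in> set bs" for b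
    proof -
      have b: "b \<in> carrier R" using that bs(1) by blast
      have uU: "u \<in> Units R" using u assms(7) field_Units by simp
      then have iu: "inv u \<in> carrier R" by simp
      obtain m :: nat where m: "a [^] m \<otimes> (inv u \<otimes> b) \<in> Span D bs" using bs(2) iu b by blast
      have am: "a [^] m \<in> carrier R" using a by simp
      have "u \<otimes> (a [^] m \<otimes> (inv u \<otimes> b)) = a [^] m \<otimes> ((u \<otimes> inv u) \<otimes> b)"
        using u iu b am by algebra
      also have "\<dots> = a [^] m \<otimes> b" using uU b by simp
      finally show ?thesis using m pV by metis
    qed
  qed
  then obtain i :: nat and e where w: "e \<in> D" "\<And>b. b \<in> set bs \<Longrightarrow> (a [^] i \<oplus> u \<otimes> e) \<otimes> b = \<zero>"
    unfolding V_def by blast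
  have e: "e \<in> carrier R" using w D(1) by blast
  have ai: "a [^] i \<in> carrier R" using a by simp
  show ?thesis
  proof (cases "a [^] i \<oplus> u \<otimes> e = \<zero>")
    case True
    have "a [^] i = (a [^] i \<oplus> u \<otimes> e) \<oplus> u \<otimes> (\<ominus> e)" using ai u e by algebra
    then have "a [^] i = u \<otimes> (\<ominus> e)" unfolding True using u e by simp
    then show ?thesis using w(1) D(5) by blast
  next
    \<comment> \<open>Now all generators vanish, so some power of \<open>a\<close> is zero and
      \<open>u\<close> divides it trivially.\<close>
    case False
    have z: "submod D {\<zero>}" using D(1) by (auto intro!: submodI)
    have "b = \<zero>" if "b \<in> set bs" for b
      using w(2)[OF that] False integral[of "a [^] i \<oplus> u \<otimes> e" b] ai u e bs(1) that by auto
    then have "Span D bs \<subseteq> {\<zero>}" by (intro Span_least[OF z]) auto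
    moreover obtain m :: nat where "a [^] m \<otimes> \<one> \<in> Span D bs" using bs(2) by blast
    ultimately have "a [^] m = u \<otimes> \<zero>" using a u by auto
    then show ?thesis using D(2) by blast
  qed
qed

theorem zariski_lemma:
  assumes "subring D R" "set xs \<subseteq> carrier R" "finite_extension D xs = carrier R" "x \<in> set xs"
  shows "algebraic_elem D x"
proof -
  obtain ts where ts: "set ts \<subseteq> carrier R"
    "\<And>x. x \<in> set xs \<Longrightarrow> algebraic_elem (finite_extension D ts) x"
    "\<And>t ts'. ts = t # ts' \<Longrightarrow> \<not> algebraic_elem (finite_extension D ts') t"
    using greedy_transcendence_basis[OF assms(1,2)] by blast
  have "ts = []"
  proof (cases ts)
    \<comment> \<open>The head of the list is the element adjoined last. It was kept for being
      transcendental over the ring generated by the tail, which the divisibility of powers of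
      \<open>a\<close> contradicts.\<close>
    case (Cons t ts')
    define E where "E = finite_extension D ts"
    have E: "subring E R" unfolding E_def using subring_finite_extension[OF assms(1) ts(1)] .
    have DE: "D \<subseteq> E" unfolding E_def
      using finite_extension_incl[OF subringE(1)[OF assms(1)] ts(1)] .
    obtain a where a: "a \<in> E - {\<zero>}" "\<And>x. x \<in> set xs \<Longrightarrow> algebraic_at E a x"
      using algebraic_elem_common[OF E assms(2)] ts(2) unfolding E_def by blast
    have "finite_extension E xs = carrier R"
      using mono_finite_extension[OF DE, of xs] assms(3)
        finite_extension_in_carrier[OF subringE(1)[OF E] assms(2)] by blast
    note div = divides_power_if_algebraic[OF E _ assms(2) a(2) this]
    have t: "t \<in> carrier R" "set ts' \<subseteq> carrier R" using ts(1) Cons by auto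
    have Eeq: "E = simple_extension (finite_extension D ts') t" unfolding E_def Cons by simp
    have "algebraic_elem (finite_extension D ts') t"
      using algebraic_if_divides_powers[OF subring_finite_extension[OF assms(1) t(2)] t(1), of a] a(1) div
      unfolding Eeq by blast
    then show ?thesis using ts(3)[OF Cons] by blast
  qed simp
  then show ?thesis using ts(2)[OF assms(4)] by simp
qed

end

section \<open>Monic polynomials and their homogenizations\<close>

text \<open>This is the image of the structure map. As a subset of \<open>A\<close> it can serve as
  the ground ring for spans and extensions inside \<open>A\<close>.\<close>

definition scalars :: "('k, 'm) ring_scheme \<Rightarrow> ('k, 'a, 'n) module_scheme \<Rightarrow> 'a set" where
  "scalars K A = (\<lambda>c. c \<odot>\<^bsub>A\<^esub> \<one>\<^bsub>A\<^esub>) ` carrier K"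

text \<open>Coefficients are listed from the constant one up, the leading coefficient \<open>1\<close> being left out.\<close>

fun monic_eval :: "('k, 'a, 'n) module_scheme \<Rightarrow> 'k list \<Rightarrow> 'a \<Rightarrow> 'a" where
  "monic_eval A [] x = \<one>\<^bsub>A\<^esub>"
| "monic_eval A (c # cs) x = c \<odot>\<^bsub>A\<^esub> \<one>\<^bsub>A\<^esub> \<oplus>\<^bsub>A\<^esub> x \<otimes>\<^bsub>A\<^esub> monic_eval A cs x"

text \<open>For the monic polynomial \<open>f\<close> of degree \<open>d\<close> this is
  \<open>y ^ d f(x / y)\<close> in Horner form; \<open>Suc (length cs)\<close> is the degree
  belonging to \<open>c # cs\<close>.\<close>

fun homogenization :: "('k, 'a, 'n) module_scheme \<Rightarrow> 'k list \<Rightarrow> 'a \<Rightarrow> 'a \<Rightarrow> 'a" where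
  "homogenization A [] x y = \<one>\<^bsub>A\<^esub>"
| "homogenization A (c # cs) x y =
     c \<odot>\<^bsub>A\<^esub> (y [^]\<^bsub>A\<^esub> Suc (length cs)) \<oplus>\<^bsub>A\<^esub> x \<otimes>\<^bsub>A\<^esub> homogenization A cs x y"

text \<open>Over a field this is algebraic closedness, in a form whose failure hands over a
  polynomial to homogenize; \<open>cs \<noteq> []\<close> means positive degree.\<close>

definition monic_roots :: "('k, 'm) ring_scheme \<Rightarrow> bool" where
  "monic_roots K \<longleftrightarrow> (\<forall>cs. set cs \<subseteq> carrier K \<and> cs \<noteq> [] \<longrightarrow>
     (\<exists>r\<in>carrier K. monic_eval (self_algebra K) cs r = \<zero>\<^bsub>K\<^esub>))"

lemma self_algebra_simps [simp]:
  "carrier (self_algebra K) = carrier K"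
  "x \<otimes>\<^bsub>self_algebra K\<^esub> y = x \<otimes>\<^bsub>K\<^esub> y"
  "x \<oplus>\<^bsub>self_algebra K\<^esub> y = x \<oplus>\<^bsub>K\<^esub> y"
  "x \<odot>\<^bsub>self_algebra K\<^esub> y = x \<otimes>\<^bsub>K\<^esub> y"
  "\<one>\<^bsub>self_algebra K\<^esub> = \<one>\<^bsub>K\<^esub>"
  "\<zero>\<^bsub>self_algebra K\<^esub> = \<zero>\<^bsub>K\<^esub>"
  by (simp_all add: self_algebra_def)

lemma self_algebra_pow [simp]: "x [^]\<^bsub>self_algebra K\<^esub> (n::nat) = x [^]\<^bsub>K\<^esub> n"
  by (simp add: nat_pow_def)

locale cring_algebra = K: cring K + A: cring A + algebra K A
  for K :: "('k, 'm) ring_scheme" and A :: "('k, 'a, 'n) module_scheme"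

lemma algebra_imp_cring_algebra: "algebra K A \<Longrightarrow> cring_algebra K A"
  by (intro cring_algebra.intro algebra.R_cring algebra.M_cring)

context cring_algebra
begin

lemma scalar_add:
  "c \<in> carrier K \<Longrightarrow> d \<in> carrier K \<Longrightarrow> (c \<oplus>\<^bsub>K\<^esub> d) \<odot>\<^bsub>A\<^esub> \<one>\<^bsub>A\<^esub> = c \<odot>\<^bsub>A\<^esub> \<one>\<^bsub>A\<^esub> \<oplus>\<^bsub>A\<^esub> d \<odot>\<^bsub>A\<^esub> \<one>\<^bsub>A\<^esub>"
  by (simp add: smult_l_distr)

lemma smult_eq_scalar_mult:
  "c \<in> carrier K \<Longrightarrow> x \<in> carrier A \<Longrightarrow> c \<odot>\<^bsub>A\<^esub> x = (c \<odot>\<^bsub>A\<^esub> \<one>\<^bsub>A\<^esub>) \<otimes>\<^bsub>A\<^esub> x"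
  by (simp add: smult_assoc2)

lemma scalar_mult:
  "c \<in> carrier K \<Longrightarrow> d \<in> carrier K \<Longrightarrow> (c \<otimes>\<^bsub>K\<^esub> d) \<odot>\<^bsub>A\<^esub> \<one>\<^bsub>A\<^esub> = (c \<odot>\<^bsub>A\<^esub> \<one>\<^bsub>A\<^esub>) \<otimes>\<^bsub>A\<^esub> (d \<odot>\<^bsub>A\<^esub> \<one>\<^bsub>A\<^esub>)"
  using smult_eq_scalar_mult[of c "d \<odot>\<^bsub>A\<^esub> \<one>\<^bsub>A\<^esub>"] by (simp add: smult_assoc1)

lemma subring_scalars: "subring (scalars K A) A"
proof -
  show ?thesis
  proof (rule A.subringI)
    show "\<one>\<^bsub>A\<^esub> \<in> scalars K A"
      unfolding scalars_def by (rule image_eqI[of _ _ "\<one>\<^bsub>K\<^esub>"]) auto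
    fix h assume "h \<in> scalars K A"
    then obtain c where c: "c \<in> carrier K" "h = c \<odot>\<^bsub>A\<^esub> \<one>\<^bsub>A\<^esub>" unfolding scalars_def by blast
    show "\<ominus>\<^bsub>A\<^esub> h \<in> scalars K A"
      unfolding scalars_def by (rule image_eqI[of _ _ "\<ominus>\<^bsub>K\<^esub> c"]) (use c in \<open>simp_all add: smult_l_minus\<close>)
    fix k assume "k \<in> scalars K A"
    then obtain d where d: "d \<in> carrier K" "k = d \<odot>\<^bsub>A\<^esub> \<one>\<^bsub>A\<^esub>" unfolding scalars_def by blast
    show "h \<otimes>\<^bsub>A\<^esub> k \<in> scalars K A"
      unfolding scalars_def by (rule image_eqI[of _ _ "c \<otimes>\<^bsub>K\<^esub> d"]) (use c d in \<open>simp_all add: scalar_mult\<close>)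
    show "h \<oplus>\<^bsub>A\<^esub> k \<in> scalars K A"
      unfolding scalars_def by (rule image_eqI[of _ _ "c \<oplus>\<^bsub>K\<^esub> d"]) (use c d in \<open>simp_all add: scalar_add\<close>)
  qed (auto simp: scalars_def)
qed

text \<open>A nonzero ideal in a homomorphic image of a field contains the unit.\<close>

lemma noetherian_scalars:
  assumes "field K"
  shows "A.noetherian_subring (scalars K A)"
proof -
  interpret K: field K by fact
  have "\<exists>bs. set bs \<subseteq> J \<and> J \<subseteq> A.Span (scalars K A) bs"
    if J: "A.submod (scalars K A) J" "J \<subseteq> scalars K A" for J
  proof (cases "J \<subseteq> {\<zero>\<^bsub>A\<^esub>}")
    case True
    then show ?thesis by (intro exI[of _ "[]"]) (auto simp: A.mem_Span_Nil)
  next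
    case False
    then obtain c where c: "c \<in> carrier K" "c \<odot>\<^bsub>A\<^esub> \<one>\<^bsub>A\<^esub> \<in> J" "c \<odot>\<^bsub>A\<^esub> \<one>\<^bsub>A\<^esub> \<noteq> \<zero>\<^bsub>A\<^esub>"
      using J(2) unfolding scalars_def by blast
    have "c \<noteq> \<zero>\<^bsub>K\<^esub>" using c(3) by auto
    then have "c \<in> Units K" using c(1) unfolding K.field_Units by blast
    then have i: "inv\<^bsub>K\<^esub> c \<in> carrier K" "inv\<^bsub>K\<^esub> c \<otimes>\<^bsub>K\<^esub> c = \<one>\<^bsub>K\<^esub>" by simp_all
    then have "(inv\<^bsub>K\<^esub> c \<odot>\<^bsub>A\<^esub> \<one>\<^bsub>A\<^esub>) \<otimes>\<^bsub>A\<^esub> (c \<odot>\<^bsub>A\<^esub> \<one>\<^bsub>A\<^esub>) = \<one>\<^bsub>A\<^esub>"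
      using scalar_mult[OF i(1) c(1)] by simp
    moreover have "inv\<^bsub>K\<^esub> c \<odot>\<^bsub>A\<^esub> \<one>\<^bsub>A\<^esub> \<in> scalars K A" using i(1) unfolding scalars_def by blast
    ultimately have one: "\<one>\<^bsub>A\<^esub> \<in> J"
      using A.submodE(4)[OF J(1) _ c(2), of "inv\<^bsub>K\<^esub> c \<odot>\<^bsub>A\<^esub> \<one>\<^bsub>A\<^esub>"] by simp
    have "f \<in> A.Span (scalars K A) [\<one>\<^bsub>A\<^esub>]" if f: "f \<in> J" for f
      using subsetD[OF A.submodE(1)[OF J(1)] f] by (intro A.Span_singletonI[OF subsetD[OF J(2) f]]) simp
    then show ?thesis using one by (intro exI[of _ "[\<one>\<^bsub>A\<^esub>]"]) auto
  qed
  then show ?thesis using subring_scalars unfolding A.noetherian_subring_def by blast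
qed

lemma monic_eval_closed [simp]:
  "set cs \<subseteq> carrier K \<Longrightarrow> x \<in> carrier A \<Longrightarrow> monic_eval A cs x \<in> carrier A"
  by (induction cs) auto

lemma homogenization_closed [simp]:
  "set cs \<subseteq> carrier K \<Longrightarrow> x \<in> carrier A \<Longrightarrow> y \<in> carrier A \<Longrightarrow> homogenization A cs x y \<in> carrier A"
  by (induction cs) auto

text \<open>Division by \<open>X - r\<close> leaves the value at \<open>r\<close> as remainder. The
  quotient has coefficients in \<open>K\<close> and is found once for all \<open>x\<close> in
  \<open>A\<close>.\<close>

lemma synthetic_division:
  assumes "set (c # cs) \<subseteq> carrier K" "r \<in> carrier K"
  shows "\<exists>qs. set qs \<subseteq> carrier K \<and> length qs = length cs \<and> (\<forall>x\<in>carrier A.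
    monic_eval A (c # cs) x = (x \<ominus>\<^bsub>A\<^esub> r \<odot>\<^bsub>A\<^esub> \<one>\<^bsub>A\<^esub>) \<otimes>\<^bsub>A\<^esub> monic_eval A qs x \<oplus>\<^bsub>A\<^esub>
      monic_eval (self_algebra K) (c # cs) r \<odot>\<^bsub>A\<^esub> \<one>\<^bsub>A\<^esub>)"
  using assms(1)
proof (induction cs arbitrary: c)
  case Nil
  have "c \<odot>\<^bsub>A\<^esub> \<one>\<^bsub>A\<^esub> \<oplus>\<^bsub>A\<^esub> x = x \<ominus>\<^bsub>A\<^esub> r \<odot>\<^bsub>A\<^esub> \<one>\<^bsub>A\<^esub> \<oplus>\<^bsub>A\<^esub> (c \<oplus>\<^bsub>K\<^esub> r) \<odot>\<^bsub>A\<^esub> \<one>\<^bsub>A\<^esub>"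
    if x: "x \<in> carrier A" for x
  proof -
    have c: "c \<odot>\<^bsub>A\<^esub> \<one>\<^bsub>A\<^esub> \<in> carrier A" "r \<odot>\<^bsub>A\<^esub> \<one>\<^bsub>A\<^esub> \<in> carrier A" using Nil assms by auto
    have cr: "(c \<oplus>\<^bsub>K\<^esub> r) \<odot>\<^bsub>A\<^esub> \<one>\<^bsub>A\<^esub> = c \<odot>\<^bsub>A\<^esub> \<one>\<^bsub>A\<^esub> \<oplus>\<^bsub>A\<^esub> r \<odot>\<^bsub>A\<^esub> \<one>\<^bsub>A\<^esub>" using Nil assms scalar_add by simp
    show ?thesis unfolding cr using c x by algebra
  qed
  then show ?case using Nil assms(2) by (intro exI[of _ "[]"]) auto
next
  case (Cons d cs)
  interpret S: cring_algebra K "self_algebra K"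
    by (intro algebra_imp_cring_algebra self_algebra_algebra K.is_cring)
  \<comment> \<open>As in Horner's scheme, the value of the tail at \<open>r\<close> is the next
    coefficient of the quotient.\<close>
  define s where "s = monic_eval (self_algebra K) (d # cs) r"
  have s: "s \<in> carrier K" unfolding s_def using Cons.prems assms(2) S.monic_eval_closed[of "d # cs" r] by simp
  obtain qs where qs: "set qs \<subseteq> carrier K" "length qs = length cs"
    "\<And>x. x \<in> carrier A \<Longrightarrow> monic_eval A (d # cs) x = (x \<ominus>\<^bsub>A\<^esub> r \<odot>\<^bsub>A\<^esub> \<one>\<^bsub>A\<^esub>) \<otimes>\<^bsub>A\<^esub> monic_eval A qs x \<oplus>\<^bsub>A\<^esub> s \<odot>\<^bsub>A\<^esub> \<one>\<^bsub>A\<^esub>"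
    using Cons.IH[of d] Cons.prems unfolding s_def list.set by blast
  have "monic_eval A (c # d # cs) x = (x \<ominus>\<^bsub>A\<^esub> r \<odot>\<^bsub>A\<^esub> \<one>\<^bsub>A\<^esub>) \<otimes>\<^bsub>A\<^esub> monic_eval A (s # qs) x \<oplus>\<^bsub>A\<^esub>
      monic_eval (self_algebra K) (c # d # cs) r \<odot>\<^bsub>A\<^esub> \<one>\<^bsub>A\<^esub>" if x: "x \<in> carrier A" for x
  proof -
    have q: "monic_eval A qs x \<in> carrier A" using qs(1) x by simp
    have c: "c \<odot>\<^bsub>A\<^esub> \<one>\<^bsub>A\<^esub> \<in> carrier A" "r \<odot>\<^bsub>A\<^esub> \<one>\<^bsub>A\<^esub> \<in> carrier A" "s \<odot>\<^bsub>A\<^esub> \<one>\<^bsub>A\<^esub> \<in> carrier A"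
      using Cons.prems assms s by auto
    have "monic_eval (self_algebra K) (c # d # cs) r = c \<oplus>\<^bsub>K\<^esub> r \<otimes>\<^bsub>K\<^esub> s"
      using Cons.prems by (simp add: s_def)
    then have e: "monic_eval (self_algebra K) (c # d # cs) r \<odot>\<^bsub>A\<^esub> \<one>\<^bsub>A\<^esub> =
        c \<odot>\<^bsub>A\<^esub> \<one>\<^bsub>A\<^esub> \<oplus>\<^bsub>A\<^esub> (r \<odot>\<^bsub>A\<^esub> \<one>\<^bsub>A\<^esub>) \<otimes>\<^bsub>A\<^esub> (s \<odot>\<^bsub>A\<^esub> \<one>\<^bsub>A\<^esub>)"
      using Cons.prems assms(2) s by (simp add: scalar_add scalar_mult)
    have m: "monic_eval A (c # d # cs) x = c \<odot>\<^bsub>A\<^esub> \<one>\<^bsub>A\<^esub> \<oplus>\<^bsub>A\<^esub> x \<otimes>\<^bsub>A\<^esub> monic_eval A (d # cs) x" by simp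
    have m2: "monic_eval A (s # qs) x = s \<odot>\<^bsub>A\<^esub> \<one>\<^bsub>A\<^esub> \<oplus>\<^bsub>A\<^esub> x \<otimes>\<^bsub>A\<^esub> monic_eval A qs x" by simp
    show ?thesis unfolding e m m2 qs(3)[OF x] using q c x by algebra
  qed
  moreover have "set (s # qs) \<subseteq> carrier K" "length (s # qs) = length (d # cs)" using qs(1,2) s by auto
  ultimately show ?case by blast
qed

text \<open>A root in \<open>K\<close> splits off a linear factor, and in a domain \<open>x\<close>
  is a root of this factor or of the quotient, whose degree is smaller.\<close>

lemma root_is_scalar:
  assumes "monic_roots K" "domain A" "set cs \<subseteq> carrier K" "x \<in> carrier A" "monic_eval A cs x = \<zero>\<^bsub>A\<^esub>"
  shows "x \<in> scalars K A"
  using assms(3,5)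
proof (induction "length cs" arbitrary: cs)
  case 0
  then show ?case using domain.one_not_zero[OF assms(2)] by simp
next
  case (Suc n)
  interpret A: domain A by fact
  obtain c cs' where cs: "cs = c # cs'" using Suc(2) by (cases cs) auto
  obtain r where r: "r \<in> carrier K" "monic_eval (self_algebra K) cs r = \<zero>\<^bsub>K\<^esub>"
    using assms(1) Suc.prems cs unfolding monic_roots_def by blast
  obtain qs where qs: "set qs \<subseteq> carrier K" "length qs = length cs'"
    "monic_eval A cs x = (x \<ominus>\<^bsub>A\<^esub> r \<odot>\<^bsub>A\<^esub> \<one>\<^bsub>A\<^esub>) \<otimes>\<^bsub>A\<^esub> monic_eval A qs x \<oplus>\<^bsub>A\<^esub> \<zero>\<^bsub>K\<^esub> \<odot>\<^bsub>A\<^esub> \<one>\<^bsub>A\<^esub>"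
    using synthetic_division[of c cs' r] Suc.prems(1) r assms(4) unfolding cs by fastforce
  have cl: "x \<ominus>\<^bsub>A\<^esub> r \<odot>\<^bsub>A\<^esub> \<one>\<^bsub>A\<^esub> \<in> carrier A" "monic_eval A qs x \<in> carrier A"
    using assms(4) r(1) qs(1) by auto
  then have "(x \<ominus>\<^bsub>A\<^esub> r \<odot>\<^bsub>A\<^esub> \<one>\<^bsub>A\<^esub>) \<otimes>\<^bsub>A\<^esub> monic_eval A qs x = \<zero>\<^bsub>A\<^esub>"
    using qs(3) Suc.prems(2) by simp
  then consider "x \<ominus>\<^bsub>A\<^esub> r \<odot>\<^bsub>A\<^esub> \<one>\<^bsub>A\<^esub> = \<zero>\<^bsub>A\<^esub>" | "monic_eval A qs x = \<zero>\<^bsub>A\<^esub>"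
    using A.integral cl by blast
  then show ?case
  proof cases
    case 1
    then have "x = r \<odot>\<^bsub>A\<^esub> \<one>\<^bsub>A\<^esub>" using assms(4) r(1) by (simp add: A.r_right_minus_eq)
    then show ?thesis using r(1) unfolding scalars_def by blast
  next
    case 2
    then show ?thesis using Suc(1)[of qs] Suc(2) qs cs by simp
  qed
qed

text \<open>Spans of powers are unfolded from the top power, \<open>monic_eval\<close> from the
  constant term; this passes from one order to the other.\<close>

lemma Span_exp_Horner:
  assumes "subring D A" "x \<in> carrier A" "y \<in> A.Span D (A.exp_base x (Suc n))"
  shows "\<exists>d\<in>D. \<exists>z\<in>A.Span D (A.exp_base x n). y = d \<oplus>\<^bsub>A\<^esub> x \<otimes>\<^bsub>A\<^esub> z"
  using assms(3)
proof (induction n arbitrary: y)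
  note D = subringE[OF assms(1)]
  note P = A.submodE[OF A.submod_Span_exp[OF assms(1,2)]]
  {
    case 0
    then obtain d where "d \<in> D" "y = d \<otimes>\<^bsub>A\<^esub> x [^]\<^bsub>A\<^esub> (0::nat) \<oplus>\<^bsub>A\<^esub> \<zero>\<^bsub>A\<^esub>"
      unfolding A.exp_base_Suc A.mem_Span_Cons A.exp_base_0 by (auto simp: A.mem_Span_Nil)
    then have "d \<in> D" "y = d \<oplus>\<^bsub>A\<^esub> x \<otimes>\<^bsub>A\<^esub> \<zero>\<^bsub>A\<^esub>" using D(1) assms(2) by auto
    then show ?case using P(2) by blast
  next
    case (Suc n)
    then obtain d v where d: "d \<in> D" "v \<in> A.Span D (A.exp_base x (Suc n))"
      "y = d \<otimes>\<^bsub>A\<^esub> x [^]\<^bsub>A\<^esub> Suc n \<oplus>\<^bsub>A\<^esub> v"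
      unfolding A.exp_base_Suc[of x "Suc n"] A.mem_Span_Cons by blast
    then obtain e z where e: "e \<in> D" "z \<in> A.Span D (A.exp_base x n)" "v = e \<oplus>\<^bsub>A\<^esub> x \<otimes>\<^bsub>A\<^esub> z"
      using Suc.IH by blast
    have c: "d \<in> carrier A" "e \<in> carrier A" "z \<in> carrier A" "x [^]\<^bsub>A\<^esub> n \<in> carrier A"
      using d e D(1) P(1) assms(2) by auto
    have "y = e \<oplus>\<^bsub>A\<^esub> x \<otimes>\<^bsub>A\<^esub> (d \<otimes>\<^bsub>A\<^esub> x [^]\<^bsub>A\<^esub> n \<oplus>\<^bsub>A\<^esub> z)"
      unfolding d(3) e(3) A.nat_pow_Suc using c assms(2) by algebra
    moreover have "d \<otimes>\<^bsub>A\<^esub> x [^]\<^bsub>A\<^esub> n \<oplus>\<^bsub>A\<^esub> z \<in> A.Span D (A.exp_base x (Suc n))"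
      using d(1) e(2) unfolding A.exp_base_Suc A.mem_Span_Cons by blast
    ultimately show ?case using e(1) by blast
  }
qed

lemma Span_scalars_monic_eval:
  assumes "x \<in> carrier A" "y \<in> A.Span (scalars K A) (A.exp_base x n)"
  shows "\<exists>cs. set cs \<subseteq> carrier K \<and> monic_eval A cs x = x [^]\<^bsub>A\<^esub> n \<oplus>\<^bsub>A\<^esub> y"
  using assms(2)
proof (induction n arbitrary: y)
  {
    case 0
    then show ?case by (intro exI[of _ "[]"]) (simp add: A.exp_base_0 A.mem_Span_Nil)
  next
    case (Suc n)
    obtain d z where "d \<in> scalars K A" "z \<in> A.Span (scalars K A) (A.exp_base x n)" "y = d \<oplus>\<^bsub>A\<^esub> x \<otimes>\<^bsub>A\<^esub> z"
      using Span_exp_Horner[OF subring_scalars assms(1) Suc.prems] by blast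
    then obtain c where c: "c \<in> carrier K" "z \<in> A.Span (scalars K A) (A.exp_base x n)"
      "y = c \<odot>\<^bsub>A\<^esub> \<one>\<^bsub>A\<^esub> \<oplus>\<^bsub>A\<^esub> x \<otimes>\<^bsub>A\<^esub> z" unfolding scalars_def by blast
    obtain cs where cs: "set cs \<subseteq> carrier K" "monic_eval A cs x = x [^]\<^bsub>A\<^esub> n \<oplus>\<^bsub>A\<^esub> z"
      using Suc.IH[OF c(2)] by blast
    have cl: "c \<odot>\<^bsub>A\<^esub> \<one>\<^bsub>A\<^esub> \<in> carrier A" "z \<in> carrier A" "x [^]\<^bsub>A\<^esub> n \<in> carrier A"
      using c A.submodE(1)[OF A.submod_Span_exp[OF subring_scalars assms(1)]] assms(1) by auto
    have "monic_eval A (c # cs) x = c \<odot>\<^bsub>A\<^esub> \<one>\<^bsub>A\<^esub> \<oplus>\<^bsub>A\<^esub> x \<otimes>\<^bsub>A\<^esub> (x [^]\<^bsub>A\<^esub> n \<oplus>\<^bsub>A\<^esub> z)" using cs by simp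
    also have "\<dots> = x [^]\<^bsub>A\<^esub> Suc n \<oplus>\<^bsub>A\<^esub> y" unfolding c(3) A.nat_pow_Suc using cl assms(1) by algebra
    finally show ?case using c(1) cs(1) by (intro exI[of _ "c # cs"]) auto
  }
qed

lemma algebraic_over_scalars_root:
  assumes "field K" "x \<in> carrier A" "A.algebraic_elem (scalars K A) x"
  shows "\<exists>cs. set cs \<subseteq> carrier K \<and> monic_eval A cs x = \<zero>\<^bsub>A\<^esub>"
proof -
  interpret K: field K by fact
  note P = A.submod_Span_exp[OF subring_scalars assms(2)]
  obtain c and n :: nat where c: "c \<in> carrier K" "c \<odot>\<^bsub>A\<^esub> \<one>\<^bsub>A\<^esub> \<noteq> \<zero>\<^bsub>A\<^esub>"
    "(c \<odot>\<^bsub>A\<^esub> \<one>\<^bsub>A\<^esub>) \<otimes>\<^bsub>A\<^esub> x [^]\<^bsub>A\<^esub> n \<in> A.Span (scalars K A) (A.exp_base x n)"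
    using assms(3) unfolding A.algebraic_elem_def A.algebraic_at_def scalars_def by blast
  have "c \<noteq> \<zero>\<^bsub>K\<^esub>" using c(2) by auto
  then have "c \<in> Units K" using c(1) unfolding K.field_Units by blast
  then have i: "inv\<^bsub>K\<^esub> c \<in> carrier K" "inv\<^bsub>K\<^esub> c \<otimes>\<^bsub>K\<^esub> c = \<one>\<^bsub>K\<^esub>" by simp_all
  have cl: "inv\<^bsub>K\<^esub> c \<odot>\<^bsub>A\<^esub> \<one>\<^bsub>A\<^esub> \<in> carrier A" "c \<odot>\<^bsub>A\<^esub> \<one>\<^bsub>A\<^esub> \<in> carrier A" "x [^]\<^bsub>A\<^esub> n \<in> carrier A"
    using i c assms by auto
  have "(inv\<^bsub>K\<^esub> c \<odot>\<^bsub>A\<^esub> \<one>\<^bsub>A\<^esub>) \<otimes>\<^bsub>A\<^esub> (c \<odot>\<^bsub>A\<^esub> \<one>\<^bsub>A\<^esub>) = \<one>\<^bsub>A\<^esub>"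
    using scalar_mult[OF i(1) c(1)] i(2) by simp
  then have x: "(inv\<^bsub>K\<^esub> c \<odot>\<^bsub>A\<^esub> \<one>\<^bsub>A\<^esub>) \<otimes>\<^bsub>A\<^esub> ((c \<odot>\<^bsub>A\<^esub> \<one>\<^bsub>A\<^esub>) \<otimes>\<^bsub>A\<^esub> x [^]\<^bsub>A\<^esub> n) = x [^]\<^bsub>A\<^esub> n"
    using A.m_assoc[OF cl, symmetric] cl(3) by simp
  have "inv\<^bsub>K\<^esub> c \<odot>\<^bsub>A\<^esub> \<one>\<^bsub>A\<^esub> \<in> scalars K A" using i(1) unfolding scalars_def by blast
  from A.submodE(4)[OF P this c(3)] have "x [^]\<^bsub>A\<^esub> n \<in> A.Span (scalars K A) (A.exp_base x n)"
    unfolding x .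
  \<comment> \<open>The lower part of the polynomial is taken to represent the negative of
    \<open>x ^ n\<close>.\<close>
  from Span_scalars_monic_eval[OF assms(2) A.submod_minus[OF subring_scalars P this]]
  show ?thesis unfolding A.r_neg[OF cl(3)] .
qed

end

section \<open>Common zeros of ideals and algebra homomorphisms\<close>

lemma alg_homD:
  assumes "h \<in> alg_hom K A B"
  shows "h \<in> ring_hom A B" "c \<in> carrier K \<Longrightarrow> x \<in> carrier A \<Longrightarrow> h (c \<odot>\<^bsub>A\<^esub> x) = c \<odot>\<^bsub>B\<^esub> h x"
    "x \<in> carrier A \<Longrightarrow> h x \<in> carrier B"
    "x \<in> carrier A \<Longrightarrow> y \<in> carrier A \<Longrightarrow> h (x \<oplus>\<^bsub>A\<^esub> y) = h x \<oplus>\<^bsub>B\<^esub> h y"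
    "x \<in> carrier A \<Longrightarrow> y \<in> carrier A \<Longrightarrow> h (x \<otimes>\<^bsub>A\<^esub> y) = h x \<otimes>\<^bsub>B\<^esub> h y"
    "h \<one>\<^bsub>A\<^esub> = \<one>\<^bsub>B\<^esub>"
  using assms unfolding alg_hom_def by (auto simp: ring_hom_closed ring_hom_add ring_hom_mult ring_hom_one)

lemma alg_hom_comp:
  assumes "g \<in> alg_hom K A B" "h \<in> alg_hom K B C"
  shows "h \<circ> g \<in> alg_hom K A C"
  using assms ring_hom_trans[of g A B h C] unfolding alg_hom_def by (auto simp: ring_hom_closed)

lemma alg_hom_zero:
  assumes "ring A" "ring B" "h \<in> alg_hom K A B"
  shows "h \<zero>\<^bsub>A\<^esub> = \<zero>\<^bsub>B\<^esub>"
  using ring_hom_zero[OF alg_homD(1)[OF assms(3)] assms(1,2)] .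

lemma alg_hom_homogenization:
  assumes "algebra K A" "algebra K B" "h \<in> alg_hom K A B" "set cs \<subseteq> carrier K"
    "x \<in> carrier A" "y \<in> carrier A"
  shows "h (homogenization A cs x y) = homogenization B cs (h x) (h y)"
proof -
  interpret cring_algebra K A by (rule algebra_imp_cring_algebra[OF assms(1)])
  interpret B: cring_algebra K B by (rule algebra_imp_cring_algebra[OF assms(2)])
  note h = alg_homD[OF assms(3)]
  have pow: "h (y [^]\<^bsub>A\<^esub> (n::nat)) = h y [^]\<^bsub>B\<^esub> n" for n
    by (induction n) (use assms in \<open>simp_all add: h\<close>)
  show ?thesis using assms(4)
  proof (induction cs)
    case (Cons c cs)
    have c: "c \<in> carrier K" "set cs \<subseteq> carrier K" using Cons.prems by auto
    have "homogenization A cs x y \<in> carrier A" using c(2) assms by simp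
    then show ?case using c assms(5,6) Cons.IH pow[of "Suc (length cs)"]
      by (simp add: h del: A.nat_pow_Suc B.A.nat_pow_Suc)
  qed (simp add: h)
qed

section \<open>Binary forms with only the trivial zero\<close>

context field
begin

lemma homogenization_zero_right:
  assumes "set cs \<subseteq> carrier R" "s \<in> carrier R"
  shows "homogenization (self_algebra R) cs s \<zero> = s [^] length cs"
  using assms
proof (induction cs)
  case (Cons c cs)
  then show ?case by (simp add: m_comm)
qed simp

lemma homogenization_eq_monic_eval:
  assumes "set cs \<subseteq> carrier R" "s \<in> carrier R" "t \<in> carrier R" "t \<noteq> \<zero>"
  shows "homogenization (self_algebra R) cs s t =
    t [^] length cs \<otimes> monic_eval (self_algebra R) cs (s \<otimes> inv t)"
  using assms(1)
proof (induction cs)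
  case (Cons c cs)
  interpret S: cring_algebra R "self_algebra R"
    by (intro algebra_imp_cring_algebra self_algebra_algebra is_cring)
  have tU: "t \<in> Units R" using assms(3,4) unfolding field_Units by blast
  have i: "inv t \<in> carrier R" "t \<otimes> inv t = \<one>" using tU by simp_all
  have c: "c \<in> carrier R" "set cs \<subseteq> carrier R" using Cons.prems by auto
  define m where "m = monic_eval (self_algebra R) cs (s \<otimes> inv t)"
  have m: "m \<in> carrier R" unfolding m_def using S.monic_eval_closed[of cs "s \<otimes> inv t"] c assms i by simp
  have e: "p \<otimes> t \<otimes> (c \<oplus> s \<otimes> inv t \<otimes> m) = c \<otimes> (p \<otimes> t) \<oplus> s \<otimes> (p \<otimes> ((t \<otimes> inv t) \<otimes> m))"
    if "p \<in> carrier R" for p using that i(1) c(1) m assms(2,3) by algebra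
  have "homogenization (self_algebra R) (c # cs) s t = c \<otimes> (t [^] length cs \<otimes> t) \<oplus> s \<otimes> (t [^] length cs \<otimes> m)"
    using Cons.IH[OF c(2)] by (simp add: m_def)
  also have "\<dots> = t [^] length cs \<otimes> t \<otimes> (c \<oplus> s \<otimes> inv t \<otimes> m)"
    using e[of "t [^] length cs"] m assms(3) unfolding i(2) by simp
  finally show ?case using c(1) by (simp add: m_def)
qed simp

text \<open>A zero with \<open>t \<noteq> \<zero>\<close> would give the root \<open>s / t\<close>.
  For \<open>t = \<zero>\<close> the form reduces to a power of \<open>s\<close>, the polynomial
  being monic.\<close>

lemma homogenization_anisotropic:
  assumes "set cs \<subseteq> carrier R" "\<And>r. r \<in> carrier R \<Longrightarrow> monic_eval (self_algebra R) cs r \<noteq> \<zero>"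
    "s \<in> carrier R" "t \<in> carrier R" "homogenization (self_algebra R) cs s t = \<zero>"
  shows "s = \<zero>" "t = \<zero>"
proof -
  interpret S: cring_algebra R "self_algebra R"
    by (intro algebra_imp_cring_algebra self_algebra_algebra is_cring)
  have pow: "x = \<zero>" if "x \<in> carrier R" "x [^] (n::nat) = \<zero>" for x n
    using that by (induction n) (auto simp: integral_iff)
  show t: "t = \<zero>"
  proof (rule ccontr)
    assume t: "t \<noteq> \<zero>"
    then have "t \<in> Units R" using assms(4) unfolding field_Units by blast
    then have r: "s \<otimes> inv t \<in> carrier R" using assms(3) by simp
    have "t [^] length cs \<otimes> monic_eval (self_algebra R) cs (s \<otimes> inv t) = \<zero>"
      using homogenization_eq_monic_eval[OF assms(1,3,4) t] assms(5) by simp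
    then have "t [^] length cs = \<zero> \<or> monic_eval (self_algebra R) cs (s \<otimes> inv t) = \<zero>"
      using integral assms(4) S.monic_eval_closed[OF assms(1), of "s \<otimes> inv t"] r by simp
    then show False using assms(2)[OF r] pow[OF assms(4)] t by blast
  qed
  show "s = \<zero>"
    using assms(5) homogenization_zero_right[OF assms(1,3)] pow[OF assms(3)] unfolding t by simp
qed

end

lemma common_zero_witness:
  assumes "field K" "algebra K A" "ideal I A" "set cs \<subseteq> carrier K" "cs \<noteq> []"
    "\<And>r. r \<in> carrier K \<Longrightarrow> monic_eval (self_algebra K) cs r \<noteq> \<zero>\<^bsub>K\<^esub>" "set bs \<subseteq> I"
  shows "\<exists>g\<in>I. \<forall>h\<in>alg_hom K A (self_algebra K). h g = \<zero>\<^bsub>K\<^esub> \<longrightarrow> (\<forall>b\<in>set bs. h b = \<zero>\<^bsub>K\<^esub>)"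
proof -
  interpret cring_algebra K A by (rule algebra_imp_cring_algebra[OF assms(2)])
  interpret I: ideal I A by fact
  interpret K: field K by fact
  note sa = self_algebra_algebra[OF K.is_cring]
  show ?thesis using assms(7)
  proof (induction bs)
    case Nil
    show ?case by (rule bexI[OF _ additive_subgroup.zero_closed[OF I.is_additive_subgroup]]) simp
  next
    case (Cons b bs)
    then obtain g where g: "g \<in> I"
      "\<And>h. h \<in> alg_hom K A (self_algebra K) \<Longrightarrow> h g = \<zero>\<^bsub>K\<^esub> \<Longrightarrow> \<forall>b\<in>set bs. h b = \<zero>\<^bsub>K\<^esub>" by auto
    have b: "b \<in> I" using Cons.prems by auto
    have c: "g \<in> carrier A" "b \<in> carrier A" using g b I.a_Hcarr by auto
    \<comment> \<open>The degree is positive: the constant coefficient comes with a power of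
      \<open>b\<close> and the rest has the factor \<open>g\<close>, so the form takes its value in
      \<open>I\<close>.\<close>
    obtain d ds where cs: "cs = d # ds" using assms(5) by (cases cs) auto
    have d: "d \<in> carrier K" "set ds \<subseteq> carrier K" using assms(4) unfolding cs by auto
    have "(d \<odot>\<^bsub>A\<^esub> \<one>\<^bsub>A\<^esub> \<otimes>\<^bsub>A\<^esub> b [^]\<^bsub>A\<^esub> length ds) \<otimes>\<^bsub>A\<^esub> b \<in> I"
      using b c d by (intro I.I_l_closed) auto
    then have "d \<odot>\<^bsub>A\<^esub> b [^]\<^bsub>A\<^esub> Suc (length ds) \<in> I"
      using c d smult_eq_scalar_mult[of d "b [^]\<^bsub>A\<^esub> Suc (length ds)"] by (simp add: A.m_assoc)
    moreover have "g \<otimes>\<^bsub>A\<^esub> homogenization A ds g b \<in> I"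
      using g(1) c d by (intro I.I_r_closed) auto
    ultimately have w: "homogenization A cs g b \<in> I" unfolding cs homogenization.simps by (rule additive_subgroup.a_closed[OF I.is_additive_subgroup])
    have "\<forall>x\<in>set (b # bs). h x = \<zero>\<^bsub>K\<^esub>"
      if h: "h \<in> alg_hom K A (self_algebra K)" "h (homogenization A cs g b) = \<zero>\<^bsub>K\<^esub>" for h
    proof -
      have "homogenization (self_algebra K) cs (h g) (h b) = \<zero>\<^bsub>K\<^esub>"
        using alg_hom_homogenization[OF assms(2) sa h(1) assms(4) c] h(2) by simp
      moreover have "h g \<in> carrier K" "h b \<in> carrier K" using alg_homD(3)[OF h(1)] c by auto
      ultimately have "h g = \<zero>\<^bsub>K\<^esub>" "h b = \<zero>\<^bsub>K\<^esub>"
        using K.homogenization_anisotropic[OF assms(4,6)] by auto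
      then show ?thesis using g(2)[OF h(1)] by auto
    qed
    then show ?case using w by blast
  qed
qed

section \<open>Scalars, generators and quotients of algebras\<close>

context cring_algebra
begin

lemma submod_ideal:
  assumes "ideal I A"
  shows "A.submod (carrier A) I"
proof -
  interpret I: ideal I A by fact
  show ?thesis by (rule A.submodI) (auto intro: I.a_Hcarr I.I_l_closed additive_subgroup.zero_closed additive_subgroup.a_closed I.is_additive_subgroup)
qed

lemma scalar_inj:
  assumes "field K" "\<one>\<^bsub>A\<^esub> \<noteq> \<zero>\<^bsub>A\<^esub>" "c \<in> carrier K" "d \<in> carrier K"
    "c \<odot>\<^bsub>A\<^esub> \<one>\<^bsub>A\<^esub> = d \<odot>\<^bsub>A\<^esub> \<one>\<^bsub>A\<^esub>"
  shows "c = d"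
proof (rule ccontr)
  assume "c \<noteq> d"
  interpret K: field K by fact
  define e where "e = c \<ominus>\<^bsub>K\<^esub> d"
  have e: "e \<in> carrier K" "e \<noteq> \<zero>\<^bsub>K\<^esub>"
    using assms(3,4) \<open>c \<noteq> d\<close> unfolding e_def by (auto simp: K.r_right_minus_eq)
  then have "e \<in> Units K" unfolding K.field_Units by blast
  then have i: "inv\<^bsub>K\<^esub> e \<in> carrier K" "inv\<^bsub>K\<^esub> e \<otimes>\<^bsub>K\<^esub> e = \<one>\<^bsub>K\<^esub>" by simp_all
  have "e \<odot>\<^bsub>A\<^esub> \<one>\<^bsub>A\<^esub> = \<zero>\<^bsub>A\<^esub>"
    using assms(3-5) unfolding e_def a_minus_def by (simp add: scalar_add smult_l_minus A.r_neg)
  then have "(inv\<^bsub>K\<^esub> e \<otimes>\<^bsub>K\<^esub> e) \<odot>\<^bsub>A\<^esub> \<one>\<^bsub>A\<^esub> = \<zero>\<^bsub>A\<^esub>"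
    using i(1) e(1) by (simp add: scalar_mult)
  then show False using assms(2) unfolding i(2) by simp
qed

text \<open>The structure map is injective, as \<open>K\<close> is a field and \<open>A\<close> is
  nonzero, and surjective by hypothesis; \<open>h\<close> is its inverse.\<close>

lemma alg_hom_of_scalars:
  assumes "field K" "\<one>\<^bsub>A\<^esub> \<noteq> \<zero>\<^bsub>A\<^esub>" "carrier A = scalars K A"
  shows "\<exists>h. h \<in> alg_hom K A (self_algebra K)"
proof -
  define h where "h x = (THE c. c \<in> carrier K \<and> c \<odot>\<^bsub>A\<^esub> \<one>\<^bsub>A\<^esub> = x)" for x
  have h: "h (c \<odot>\<^bsub>A\<^esub> \<one>\<^bsub>A\<^esub>) = c" if "c \<in> carrier K" for c
    unfolding h_def
  proof (rule the_equality)
    show "e = c" if "e \<in> carrier K \<and> e \<odot>\<^bsub>A\<^esub> \<one>\<^bsub>A\<^esub> = c \<odot>\<^bsub>A\<^esub> \<one>\<^bsub>A\<^esub>" for e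
      using that scalar_inj[OF assms(1,2), of e c] \<open>c \<in> carrier K\<close> by blast
  qed (use that in simp)
  have ex: "\<exists>c\<in>carrier K. x = c \<odot>\<^bsub>A\<^esub> \<one>\<^bsub>A\<^esub>" if "x \<in> carrier A" for x
    using that assms(3) unfolding scalars_def by auto
  have "h \<in> ring_hom A (self_algebra K)"
  proof (rule ring_hom_memI)
    show "h x \<in> carrier (self_algebra K)" if "x \<in> carrier A" for x
      using ex[OF that] h by auto
    show "h (x \<otimes>\<^bsub>A\<^esub> y) = h x \<otimes>\<^bsub>self_algebra K\<^esub> h y" if xy: "x \<in> carrier A" "y \<in> carrier A" for x y
    proof -
      obtain c d where "c \<in> carrier K" "d \<in> carrier K" "x = c \<odot>\<^bsub>A\<^esub> \<one>\<^bsub>A\<^esub>" "y = d \<odot>\<^bsub>A\<^esub> \<one>\<^bsub>A\<^esub>"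
        using ex[OF xy(1)] ex[OF xy(2)] by blast
      then show ?thesis
        using h[of c] h[of d] h[of "c \<otimes>\<^bsub>K\<^esub> d"] by (simp add: scalar_mult[symmetric])
    qed
    show "h (x \<oplus>\<^bsub>A\<^esub> y) = h x \<oplus>\<^bsub>self_algebra K\<^esub> h y" if xy: "x \<in> carrier A" "y \<in> carrier A" for x y
    proof -
      obtain c d where "c \<in> carrier K" "d \<in> carrier K" "x = c \<odot>\<^bsub>A\<^esub> \<one>\<^bsub>A\<^esub>" "y = d \<odot>\<^bsub>A\<^esub> \<one>\<^bsub>A\<^esub>"
        using ex[OF xy(1)] ex[OF xy(2)] by blast
      then show ?thesis
        using h[of c] h[of d] h[of "c \<oplus>\<^bsub>K\<^esub> d"] by (simp add: scalar_add[symmetric])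
    qed
    show "h \<one>\<^bsub>A\<^esub> = \<one>\<^bsub>self_algebra K\<^esub>" using h[of "\<one>\<^bsub>K\<^esub>"] by simp
  qed
  moreover have "h (c \<odot>\<^bsub>A\<^esub> x) = c \<odot>\<^bsub>self_algebra K\<^esub> h x" if cx: "c \<in> carrier K" "x \<in> carrier A" for c x
  proof -
    obtain d where "d \<in> carrier K" "x = d \<odot>\<^bsub>A\<^esub> \<one>\<^bsub>A\<^esub>" using ex[OF cx(2)] by blast
    then show ?thesis using h[of d] h[of "c \<otimes>\<^bsub>K\<^esub> d"] cx(1) by (simp add: smult_assoc1[symmetric])
  qed
  ultimately show ?thesis unfolding alg_hom_def by blast
qed

lemma finite_extension_scalars_subalgebra:
  assumes "set xs \<subseteq> carrier A"
  shows "is_subalgebra K A (A.finite_extension (scalars K A) xs)"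
proof -
  have s: "subring (A.finite_extension (scalars K A) xs) A"
    by (rule A.subring_finite_extension[OF subring_scalars assms])
  have "c \<odot>\<^bsub>A\<^esub> x \<in> A.finite_extension (scalars K A) xs"
    if "c \<in> carrier K" "x \<in> A.finite_extension (scalars K A) xs" for c x
  proof -
    have "c \<odot>\<^bsub>A\<^esub> \<one>\<^bsub>A\<^esub> \<in> scalars K A" using that(1) unfolding scalars_def by blast
    then have "c \<odot>\<^bsub>A\<^esub> \<one>\<^bsub>A\<^esub> \<in> A.finite_extension (scalars K A) xs"
      using A.finite_extension_incl[OF subringE(1)[OF subring_scalars] assms] by blast
    then have "(c \<odot>\<^bsub>A\<^esub> \<one>\<^bsub>A\<^esub>) \<otimes>\<^bsub>A\<^esub> x \<in> A.finite_extension (scalars K A) xs"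
      using subringE(6)[OF s] that(2) by blast
    moreover have "x \<in> carrier A" using that(2) subringE(1)[OF s] by blast
    ultimately show ?thesis using smult_eq_scalar_mult[OF that(1), of x] by simp
  qed
  then show ?thesis using s unfolding is_subalgebra_def by blast
qed

lemma finite_extension_scalars_mem:
  assumes "set xs \<subseteq> carrier A"
  shows "set xs \<subseteq> A.finite_extension (scalars K A) xs"
  using assms
proof (induction xs)
  case (Cons x xs)
  then have x: "x \<in> carrier A" "set xs \<subseteq> carrier A" by auto
  have "x \<in> A.finite_extension (scalars K A) (x # xs)"
    using A.simple_extension_mem[OF A.subring_finite_extension[OF subring_scalars x(2)] x(1)] by simp
  moreover have "set xs \<subseteq> A.finite_extension (scalars K A) (x # xs)"
    using Cons.IH[OF x(2)] A.finite_extension_incl_aux[OF subringE(1)[OF subring_scalars] x] by blast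
  ultimately show ?case by simp
qed simp

end

text \<open>The iterated extension is one of the subalgebras whose intersection is the whole
  algebra.\<close>

lemma fg_algebra_finite_extension:
  assumes "fg_algebra K A"
  shows "\<exists>xs. set xs \<subseteq> carrier A \<and> ring.finite_extension A (scalars K A) xs = carrier A"
proof -
  from assms have "algebra K A" unfolding fg_algebra_def by blast
  then interpret cring_algebra K A by (rule algebra_imp_cring_algebra)
  obtain G where G: "finite G" "G \<subseteq> carrier A" "\<Inter>{B. is_subalgebra K A B \<and> G \<subseteq> B} = carrier A"
    using assms unfolding fg_algebra_def by blast
  obtain xs where xs: "set xs = G" using finite_list[OF G(1)] by blast
  have xsA: "set xs \<subseteq> carrier A" using G(2) unfolding xs .
  have "\<Inter>{B. is_subalgebra K A B \<and> G \<subseteq> B} \<subseteq> A.finite_extension (scalars K A) xs"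
    using finite_extension_scalars_subalgebra[OF xsA] finite_extension_scalars_mem[OF xsA]
    unfolding xs by (intro Inter_lower) simp
  then have "carrier A \<subseteq> A.finite_extension (scalars K A) xs" unfolding G(3) .
  moreover have "A.finite_extension (scalars K A) xs \<subseteq> carrier A"
    by (rule A.finite_extension_in_carrier[OF subringE(1)[OF subring_scalars] xsA])
  ultimately show ?thesis using xsA by (intro exI[of _ xs]) simp
qed

lemma image_finite_extension:
  assumes "ring R" "ring S" "h \<in> ring_hom R S" "D \<subseteq> carrier R" "set xs \<subseteq> carrier R"
  shows "h ` ring.finite_extension R D xs \<subseteq> ring.finite_extension S (h ` D) (map h xs)"
proof -
  interpret R: ring R by fact
  interpret S: ring S by fact
  show ?thesis using assms(5)
  proof (induction xs)
    case Nil
    then show ?case by simp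
  next
    case (Cons x xs)
    have x: "x \<in> carrier R" "set xs \<subseteq> carrier R" using Cons.prems by auto
    note c = R.finite_extension_in_carrier[OF assms(4) x(2)]
    have "h y \<in> S.finite_extension (h ` D) (map h (x # xs))"
      if "y \<in> R.simple_extension (R.finite_extension D xs) x" for y
      using that
    proof induction
      case zero
      then show ?case using ring_hom_zero[OF assms(3,1,2)] by simp
    next
      case (lin y d)
      have y: "y \<in> carrier R" using lin(1) R.simple_extension_in_carrier[OF c x(1)] by blast
      have d: "d \<in> carrier R" using lin(2) c by blast
      have "h (y \<otimes>\<^bsub>R\<^esub> x \<oplus>\<^bsub>R\<^esub> d) = h y \<otimes>\<^bsub>S\<^esub> h x \<oplus>\<^bsub>S\<^esub> h d"
        using y d x(1) assms(3) by (simp add: ring_hom_add ring_hom_mult)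
      moreover have "h d \<in> S.finite_extension (h ` D) (map h xs)" using Cons.IH[OF x(2)] lin(2) by blast
      ultimately show ?case using lin.IH by (simp add: S.simple_extension.lin)
    qed
    then show ?case by auto
  qed
qed

lemma quot_algebra_hom:
  assumes "algebra K A" "ideal I A"
  shows "(+>\<^bsub>A\<^esub>) I \<in> alg_hom K A (quot_algebra A I)"
    "(+>\<^bsub>A\<^esub>) I ` carrier A = carrier (quot_algebra A I)"
    "x \<in> carrier A \<Longrightarrow> I +>\<^bsub>A\<^esub> x = \<zero>\<^bsub>quot_algebra A I\<^esub> \<longleftrightarrow> x \<in> I"
proof -
  interpret cring_algebra K A by (rule algebra_imp_cring_algebra[OF assms(1)])
  interpret I: ideal I A by fact
  have "(+>\<^bsub>A\<^esub>) I \<in> ring_hom A (quot_algebra A I)"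
    using I.rcos_ring_hom unfolding ring_hom_def quot_algebra_def by simp
  then show "(+>\<^bsub>A\<^esub>) I \<in> alg_hom K A (quot_algebra A I)"
    using quot_algebra_smult[OF assms] unfolding alg_hom_def by simp
  show "(+>\<^bsub>A\<^esub>) I ` carrier A = carrier (quot_algebra A I)"
    by (auto simp: quot_algebra_def FactRing_simps)
  show "I +>\<^bsub>A\<^esub> x = \<zero>\<^bsub>quot_algebra A I\<^esub> \<longleftrightarrow> x \<in> I" if "x \<in> carrier A"
    using that I.rcos_const_imp_mem A.a_rcos_zero[OF assms(2)]
    by (auto simp: quot_algebra_def FactRing_def)
qed

lemma quot_algebra_field:
  assumes "algebra K A" "maximalideal I A"
  shows "field (quot_algebra A I)"
proof -
  interpret cring_algebra K A by (rule algebra_imp_cring_algebra[OF assms(1)])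
  interpret I: maximalideal I A by fact
  interpret Q: field "A Quot I" by (rule I.quotient_is_field[OF A.is_cring])
  interpret QA: cring "quot_algebra A I"
    by (rule algebra.M_cring[OF quot_algebra_algebra[OF assms(1) I.is_ideal]])
  have U: "Units (quot_algebra A I) = Units (A Quot I)"
    unfolding Units_def by (simp add: quot_algebra_def)
  show ?thesis
    by (rule QA.cring_fieldI) (unfold U Q.field_Units, simp add: quot_algebra_def)
qed

section \<open>Kernels of homomorphisms to the ground field\<close>

lemma alg_hom_scalar:
  assumes "algebra K A" "h \<in> alg_hom K A (self_algebra K)" "c \<in> carrier K"
  shows "h (c \<odot>\<^bsub>A\<^esub> \<one>\<^bsub>A\<^esub>) = c"
proof -
  interpret cring_algebra K A by (rule algebra_imp_cring_algebra[OF assms(1)])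
  show ?thesis using alg_homD(2)[OF assms(2,3), of "\<one>\<^bsub>A\<^esub>"] alg_homD(6)[OF assms(2)] assms(3) by simp
qed

lemma alg_hom_kernel:
  assumes "field K" "algebra K A" "h \<in> alg_hom K A (self_algebra K)"
  defines "I \<equiv> {x \<in> carrier A. h x = \<zero>\<^bsub>K\<^esub>}"
  shows "maximalideal I A" "alg_isomorphic K (quot_algebra A I) (self_algebra K)"
proof -
  interpret cring_algebra K A by (rule algebra_imp_cring_algebra[OF assms(2)])
  interpret K: field K by fact
  note h = alg_homD[OF assms(3)]
  interpret S: cring_algebra K "self_algebra K"
    by (intro algebra_imp_cring_algebra self_algebra_algebra K.is_cring)
  interpret h: ring_hom_ring A "self_algebra K" h
    by (rule ring_hom_ringI2[OF A.ring_axioms S.A.ring_axioms h(1)])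
  have ker: "a_kernel A (self_algebra K) h = I" unfolding a_kernel_def' I_def by simp
  have I: "ideal I A" using h.kernel_is_ideal unfolding ker .
  have surj: "h ` carrier A = carrier (self_algebra K)"
  proof
    show "carrier (self_algebra K) \<subseteq> h ` carrier A"
    proof
      fix c assume "c \<in> carrier (self_algebra K)"
      then have c: "c \<in> carrier K" by simp
      show "c \<in> h ` carrier A"
        by (rule image_eqI[of _ _ "c \<odot>\<^bsub>A\<^esub> \<one>\<^bsub>A\<^esub>"]) (use alg_hom_scalar[OF assms(2,3) c] c in auto)
    qed
  qed (use h(3) in auto)
  \<comment> \<open>\<open>h\<close> is constant on each coset of its kernel, so the image of a
    coset is a singleton.\<close>
  let ?g = "\<lambda>Y. the_elem (h ` Y)"
  have g: "?g (I +>\<^bsub>A\<^esub> x) = h x" if "x \<in> carrier A" for x using h.the_elem_simp[OF that] unfolding ker .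
  have iso: "?g \<in> ring_iso (A Quot I) (self_algebra K)" using h.FactRing_iso_set[OF surj] unfolding ker .
  have "?g \<in> ring_hom (quot_algebra A I) (self_algebra K)"
    using iso unfolding ring_iso_def ring_hom_def quot_algebra_def by simp
  moreover have "?g (c \<odot>\<^bsub>quot_algebra A I\<^esub> Y) = c \<odot>\<^bsub>self_algebra K\<^esub> ?g Y"
    if c: "c \<in> carrier K" "Y \<in> carrier (quot_algebra A I)" for c Y
  proof -
    obtain x where x: "x \<in> carrier A" "Y = I +>\<^bsub>A\<^esub> x"
      using c(2) quot_algebra_hom(2)[OF assms(2) I] by blast
    show ?thesis unfolding x(2) quot_algebra_smult[OF assms(2) I c(1) x(1)]
      using g[OF x(1)] g[of "c \<odot>\<^bsub>A\<^esub> x"] h(2)[OF c(1) x(1)] c x by simp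
  qed
  moreover have "bij_betw ?g (carrier (quot_algebra A I)) (carrier (self_algebra K))"
    using iso unfolding ring_iso_def quot_algebra_def by simp
  ultimately show "alg_isomorphic K (quot_algebra A I) (self_algebra K)"
    unfolding alg_isomorphic_def alg_hom_def by (intro bexI[of _ ?g]) simp_all
  show "maximalideal I A"
  proof (rule maximalidealI[OF I])
    have "\<one>\<^bsub>A\<^esub> \<notin> I" unfolding I_def using h(6) by simp
    then show "carrier A \<noteq> I" using A.one_closed by auto
    fix J assume J: "ideal J A" "I \<subseteq> J" "J \<subseteq> carrier A"
    interpret J: ideal J A by fact
    show "J = I \<or> J = carrier A"
    proof (cases "J \<subseteq> I")
      case False
      then obtain f where f: "f \<in> J" "f \<in> carrier A" "h f \<noteq> \<zero>\<^bsub>K\<^esub>" using J(3) unfolding I_def by blast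
      define c where "c = h f"
      have c: "c \<in> carrier K" unfolding c_def using h(3)[OF f(2)] by simp
      then have "c \<in> Units K" using f(3) unfolding K.field_Units c_def by blast
      then have i: "inv\<^bsub>K\<^esub> c \<in> carrier K" "inv\<^bsub>K\<^esub> c \<otimes>\<^bsub>K\<^esub> c = \<one>\<^bsub>K\<^esub>" by simp_all
      \<comment> \<open>Scaling \<open>f\<close> to the value \<open>1\<close> puts
        \<open>1 - g\<close> into the kernel, so \<open>J\<close> contains \<open>1 - g\<close> and
        \<open>g\<close>, hence \<open>1\<close>.\<close>
      define g where "g = (inv\<^bsub>K\<^esub> c \<odot>\<^bsub>A\<^esub> \<one>\<^bsub>A\<^esub>) \<otimes>\<^bsub>A\<^esub> f"
      have ic: "inv\<^bsub>K\<^esub> c \<odot>\<^bsub>A\<^esub> \<one>\<^bsub>A\<^esub> \<in> carrier A" using i(1) by simp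
      have gJ: "g \<in> J" unfolding g_def using J.I_l_closed[OF f(1) ic] .
      then have gA: "g \<in> carrier A" using J(3) by blast
      have "h g = \<one>\<^bsub>K\<^esub>"
        unfolding g_def h(5)[OF ic f(2)] alg_hom_scalar[OF assms(2,3) i(1)] using i(2) by (simp add: c_def)
      moreover have "h (\<ominus>\<^bsub>A\<^esub> g) = \<ominus>\<^bsub>self_algebra K\<^esub> h g" using gA by simp
      moreover have "\<one>\<^bsub>self_algebra K\<^esub> \<oplus>\<^bsub>self_algebra K\<^esub> \<ominus>\<^bsub>self_algebra K\<^esub> \<one>\<^bsub>self_algebra K\<^esub> = \<zero>\<^bsub>self_algebra K\<^esub>"
        by (rule S.A.r_neg) simp
      ultimately have "h (\<one>\<^bsub>A\<^esub> \<oplus>\<^bsub>A\<^esub> \<ominus>\<^bsub>A\<^esub> g) = \<zero>\<^bsub>K\<^esub>"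
        using h(4)[OF A.one_closed A.a_inv_closed[OF gA]] h(6) by simp
      then have "\<one>\<^bsub>A\<^esub> \<oplus>\<^bsub>A\<^esub> \<ominus>\<^bsub>A\<^esub> g \<in> J" using J(2) gA unfolding I_def by auto
      then have "(\<one>\<^bsub>A\<^esub> \<oplus>\<^bsub>A\<^esub> \<ominus>\<^bsub>A\<^esub> g) \<oplus>\<^bsub>A\<^esub> g \<in> J"
        using additive_subgroup.a_closed[OF J.is_additive_subgroup] gJ by blast
      moreover have "(\<one>\<^bsub>A\<^esub> \<oplus>\<^bsub>A\<^esub> \<ominus>\<^bsub>A\<^esub> g) \<oplus>\<^bsub>A\<^esub> g = \<one>\<^bsub>A\<^esub>" using gA by algebra
      ultimately show ?thesis using J.one_imp_carrier by simp
    qed (use J(2) in blast)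
  qed
qed

section \<open>Homomorphisms that vanish on a given ideal\<close>

lemma fg_algebra_noetherian_subring:
  assumes "field K" "fg_algebra K A"
  shows "ring.noetherian_subring A (carrier A)"
proof -
  have "algebra K A" using assms(2) unfolding fg_algebra_def by blast
  then interpret cring_algebra K A by (rule algebra_imp_cring_algebra)
  obtain xs where "set xs \<subseteq> carrier A" "A.finite_extension (scalars K A) xs = carrier A"
    using fg_algebra_finite_extension[OF assms(2)] by blast
  then show ?thesis using A.noetherian_finite_extension[OF noetherian_scalars[OF assms(1)], of xs] by simp
qed

lemma (in cring_algebra) ideal_generators:
  assumes "A.noetherian_subring (carrier A)" "ideal I A"
  shows "\<exists>bs. set bs \<subseteq> I \<and> I \<subseteq> A.Span (carrier A) bs"
proof -
  have "I \<subseteq> carrier A" using ideal.Icarr[OF assms(2)] by blast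
  then show ?thesis using assms(1) submod_ideal[OF assms(2)] unfolding A.noetherian_subring_def by blast
qed

lemma (in cring_algebra) exists_maximalideal:
  assumes "A.noetherian_subring (carrier A)" "ideal I A" "\<one>\<^bsub>A\<^esub> \<notin> I"
  shows "\<exists>J. maximalideal J A \<and> I \<subseteq> J"
proof -
  interpret N: noetherian_ring A
  proof (rule A.noetherian_ringI)
    fix J assume J: "ideal J A"
    obtain bs where bs: "set bs \<subseteq> J" "J \<subseteq> A.Span (carrier A) bs"
      using ideal_generators[OF assms(1) J] by blast
    have bc: "set bs \<subseteq> carrier A" using bs(1) ideal.Icarr[OF J] by blast
    have "A.Span (carrier A) bs \<subseteq> Idl\<^bsub>A\<^esub> set bs"
      by (rule A.Span_least[OF submod_ideal[OF A.genideal_ideal[OF bc]] A.genideal_self[OF bc]])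
    then have "J = Idl\<^bsub>A\<^esub> set bs" using bs(2) A.genideal_minimal[OF J bs(1)] by blast
    then show "\<exists>S\<subseteq>carrier A. finite S \<and> J = Idl\<^bsub>A\<^esub> S" using bc by (intro exI[of _ "set bs"]) simp
  qed
  let ?F = "{J. ideal J A \<and> I \<subseteq> J \<and> \<one>\<^bsub>A\<^esub> \<notin> J}"
  have "\<exists>M\<in>?F. \<forall>Y\<in>?F. M \<subseteq> Y \<longrightarrow> Y = M"
  proof (rule subset_Zorn_nonempty)
    show "?F \<noteq> {}" using assms(2,3) by blast
    fix C assume C: "C \<noteq> {}" "subset.chain ?F C"
    then have "subset.chain {J. ideal J A} C" unfolding pred_on.chain_def by blast
    \<comment> \<open>In a noetherian ring a nonempty chain of ideals contains its own union, which
      is therefore an upper bound inside the family.\<close>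
    then have "\<Union>C \<in> C" by (rule N.ideal_chain_is_trivial[OF C(1)])
    then show "\<Union>C \<in> ?F" using C(2) unfolding pred_on.chain_def by blast
  qed
  then obtain M where "M \<in> ?F" and max: "\<forall>J\<in>?F. M \<subseteq> J \<longrightarrow> J = M" by (rule bexE)
  then have M: "ideal M A" "I \<subseteq> M" "\<one>\<^bsub>A\<^esub> \<notin> M" by simp_all
  have "maximalideal M A"
  proof (rule maximalidealI[OF M(1)])
    show "carrier A \<noteq> M" using M(3) A.one_closed by auto
    show "J = M \<or> J = carrier A" if J: "ideal J A" "M \<subseteq> J" for J
    proof (cases "\<one>\<^bsub>A\<^esub> \<in> J")
      case True
      then show ?thesis using ideal.one_imp_carrier[OF J(1)] by simp
    next
      case False
      then have "J \<in> ?F" using J M(2) by simp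
      then show ?thesis using max J(2) by blast
    qed
  qed
  then show ?thesis using M(2) by blast
qed

text \<open>The residue field of a maximal ideal above \<open>I\<close> is generated by the images
  of the generators of \<open>A\<close>. These are algebraic by Zariski's lemma and hence scalars,
  so the residue field is \<open>K\<close> and the projection serves as \<open>h\<close>.\<close>

lemma exists_alg_hom_of_monic_roots:
  assumes "field K" "fg_algebra K A" "monic_roots K" "ideal I A" "\<one>\<^bsub>A\<^esub> \<notin> I"
  shows "\<exists>h\<in>alg_hom K A (self_algebra K). \<forall>f\<in>I. h f = \<zero>\<^bsub>K\<^esub>"
proof -
  have alg: "algebra K A" using assms(2) unfolding fg_algebra_def by blast
  then interpret cring_algebra K A by (rule algebra_imp_cring_algebra)
  interpret K: field K by fact
  obtain xs where xs: "set xs \<subseteq> carrier A" "A.finite_extension (scalars K A) xs = carrier A"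
    using fg_algebra_finite_extension[OF assms(2)] by blast
  obtain M where M: "maximalideal M A" "I \<subseteq> M"
    using exists_maximalideal[OF fg_algebra_noetherian_subring[OF assms(1,2)] assms(4,5)] by blast
  have Mi: "ideal M A" using M(1) unfolding maximalideal_def by blast
  define Q where "Q = quot_algebra A M"
  have algQ: "algebra K Q" unfolding Q_def using quot_algebra_algebra[OF alg Mi] .
  interpret Q: cring_algebra K Q by (rule algebra_imp_cring_algebra[OF algQ])
  interpret QF: field Q unfolding Q_def by (rule quot_algebra_field[OF alg M(1)])
  define p where "p = (+>\<^bsub>A\<^esub>) M"
  have p: "p \<in> alg_hom K A Q" "p ` carrier A = carrier Q"
    "\<And>x. x \<in> carrier A \<Longrightarrow> p x = \<zero>\<^bsub>Q\<^esub> \<longleftrightarrow> x \<in> M"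
    unfolding p_def Q_def using quot_algebra_hom[OF alg Mi] by auto
  note ph = alg_homD[OF p(1)]
  have ps: "p ` scalars K A \<subseteq> scalars K Q" unfolding scalars_def using ph(2,6) by auto
  define ys where "ys = map p xs"
  have ys: "set ys \<subseteq> carrier Q" unfolding ys_def using xs(1) ph(3) by auto
  have "carrier Q \<subseteq> Q.A.finite_extension (p ` scalars K A) ys"
    using image_finite_extension[OF A.ring_axioms Q.A.ring_axioms ph(1) subringE(1)[OF subring_scalars] xs(1)]
    unfolding xs(2) p(2) ys_def .
  also have "\<dots> \<subseteq> Q.A.finite_extension (scalars K Q) ys"
    by (rule Q.A.mono_finite_extension[OF ps])
  finally have fQ: "Q.A.finite_extension (scalars K Q) ys = carrier Q"
    using Q.A.finite_extension_in_carrier[OF subringE(1)[OF Q.subring_scalars] ys] by blast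
  have "y \<in> scalars K Q" if y: "y \<in> set ys" for y
  proof -
    have yc: "y \<in> carrier Q" using y ys by blast
    have "Q.A.algebraic_elem (scalars K Q) y"
      by (rule QF.zariski_lemma[OF Q.subring_scalars ys fQ y])
    then obtain cs where "set cs \<subseteq> carrier K" "monic_eval Q cs y = \<zero>\<^bsub>Q\<^esub>"
      using Q.algebraic_over_scalars_root[OF assms(1) yc] by blast
    then show ?thesis using Q.root_is_scalar[OF assms(3) QF.domain_axioms _ yc] by blast
  qed
  then have "Q.A.finite_extension (scalars K Q) ys \<subseteq> scalars K Q"
    by (intro Q.A.finite_extension_subring_incl Q.subring_scalars) auto
  then have "carrier Q = scalars K Q" using fQ subringE(1)[OF Q.subring_scalars] by blast
  then obtain g where g: "g \<in> alg_hom K Q (self_algebra K)"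
    using Q.alg_hom_of_scalars[OF assms(1) QF.one_not_zero] by blast
  have "ring (self_algebra K)"
    using algebra.M_cring[OF self_algebra_algebra[OF K.is_cring]] cring.axioms(1) by blast
  then have g0: "g \<zero>\<^bsub>Q\<^esub> = \<zero>\<^bsub>K\<^esub>" using alg_hom_zero[OF Q.A.ring_axioms _ g] by simp
  have "(g \<circ> p) f = \<zero>\<^bsub>K\<^esub>" if "f \<in> I" for f
    using that M(2) p(3)[of f] ideal.Icarr[OF Mi] g0 by auto
  then show ?thesis using alg_hom_comp[OF p(1) g] by blast
qed

text \<open>Disjointness is used for the single element \<open>g\<close>. A homomorphism killing
  \<open>g\<close> kills the generators of \<open>I\<close>, and its kernel, an ideal, then contains
  their span.\<close>

lemma exists_alg_hom_of_no_monic_roots: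
  assumes "field K" "fg_algebra K A" "\<not> monic_roots K" "ideal I A" "I \<inter> nonvanishing K A = {}"
  shows "\<exists>h\<in>alg_hom K A (self_algebra K). \<forall>f\<in>I. h f = \<zero>\<^bsub>K\<^esub>"
proof -
  have alg: "algebra K A" using assms(2) unfolding fg_algebra_def by blast
  then interpret cring_algebra K A by (rule algebra_imp_cring_algebra)
  interpret K: field K by fact
  obtain cs where cs: "set cs \<subseteq> carrier K" "cs \<noteq> []"
    "\<And>r. r \<in> carrier K \<Longrightarrow> monic_eval (self_algebra K) cs r \<noteq> \<zero>\<^bsub>K\<^esub>"
    using assms(3) unfolding monic_roots_def by blast
  obtain bs where bs: "set bs \<subseteq> I" "I \<subseteq> A.Span (carrier A) bs"
    using ideal_generators[OF fg_algebra_noetherian_subring[OF assms(1,2)] assms(4)] by blast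
  obtain g where g: "g \<in> I" "\<And>h. h \<in> alg_hom K A (self_algebra K) \<Longrightarrow> h g = \<zero>\<^bsub>K\<^esub> \<Longrightarrow> \<forall>b\<in>set bs. h b = \<zero>\<^bsub>K\<^esub>"
    using common_zero_witness[OF assms(1) alg assms(4) cs bs(1)] by blast
  have "g \<in> carrier A" using ideal.Icarr[OF assms(4) g(1)] .
  then obtain h where h: "h \<in> alg_hom K A (self_algebra K)" "h g = \<zero>\<^bsub>K\<^esub>"
    using g(1) assms(5) unfolding nonvanishing_def by blast
  let ?J = "{x \<in> carrier A. h x = \<zero>\<^bsub>K\<^esub>}"
  have "ideal ?J A" using alg_hom_kernel(1)[OF assms(1) alg h(1)] unfolding maximalideal_def by blast
  moreover have "set bs \<subseteq> ?J" using g(2)[OF h] bs(1) ideal.Icarr[OF assms(4)] by blast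
  ultimately have "A.Span (carrier A) bs \<subseteq> ?J" using A.Span_least submod_ideal by blast
  then show ?thesis using bs(2) h(1) by blast
qed

theorem theorem2p1:
  fixes K :: "('k, 'm) ring_scheme" and A :: "('k, 'a, 'n) module_scheme"
  assumes "field K" and "fg_algebra K A"
  shows "(\<forall>I. maximal_disjoint_ideal A (nonvanishing K A) I \<longrightarrow>
            maximalideal I A \<and> alg_isomorphic K (quot_algebra A I) (self_algebra K)) \<and>
         (\<forall>I. maximalideal I A \<and> alg_isomorphic K (quot_algebra A I) (self_algebra K) \<longrightarrow>
            maximal_disjoint_ideal A (nonvanishing K A) I)"
proof (intro conjI allI impI)
  have alg: "algebra K A" using assms(2) unfolding fg_algebra_def by blast
  then interpret cring_algebra K A by (rule algebra_imp_cring_algebra)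
  interpret K: field K by fact
  have "h \<one>\<^bsub>A\<^esub> \<noteq> \<zero>\<^bsub>K\<^esub>" if "h \<in> alg_hom K A (self_algebra K)" for h
    using alg_homD(6)[OF that] by simp
  then have one: "\<one>\<^bsub>A\<^esub> \<in> nonvanishing K A" unfolding nonvanishing_def by simp
  {
    fix I assume "maximal_disjoint_ideal A (nonvanishing K A) I"
    then have I: "ideal I A" "I \<inter> nonvanishing K A = {}"
      "\<And>J. ideal J A \<Longrightarrow> J \<inter> nonvanishing K A = {} \<Longrightarrow> I \<subseteq> J \<Longrightarrow> J = I"
      unfolding maximal_disjoint_ideal_def by blast+
    have "\<one>\<^bsub>A\<^esub> \<notin> I" using one I(2) by blast
    then obtain h where h: "h \<in> alg_hom K A (self_algebra K)" "\<And>f. f \<in> I \<Longrightarrow> h f = \<zero>\<^bsub>K\<^esub>"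
      using exists_alg_hom_of_monic_roots[OF assms _ I(1)]
        exists_alg_hom_of_no_monic_roots[OF assms _ I(1,2)] by blast
    define J where "J = {x \<in> carrier A. h x = \<zero>\<^bsub>K\<^esub>}"
    note J = alg_hom_kernel[OF assms(1) alg h(1), folded J_def]
    \<comment> \<open>\<open>h\<close> itself witnesses that no element of its kernel lies in
      \<open>S\<close>; maximality of \<open>I\<close> then forces \<open>I\<close> to be this
      kernel.\<close>
    have "J \<inter> nonvanishing K A = {}" unfolding J_def nonvanishing_def using h(1) by blast
    moreover have "I \<subseteq> J" unfolding J_def using h(2) ideal.Icarr[OF I(1)] by blast
    ultimately have "J = I" using I(3) J(1) unfolding maximalideal_def by blast
    then show "maximalideal I A" "alg_isomorphic K (quot_algebra A I) (self_algebra K)"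
      using J by simp_all
  next
    fix I assume "maximalideal I A \<and> alg_isomorphic K (quot_algebra A I) (self_algebra K)"
    then obtain g where I: "maximalideal I A" and g: "g \<in> alg_hom K (quot_algebra A I) (self_algebra K)"
      unfolding alg_isomorphic_def by blast
    have Ii: "ideal I A" using I unfolding maximalideal_def by blast
    note p = quot_algebra_hom[OF alg Ii]
    \<comment> \<open>The projection followed by the isomorphism is a homomorphism to
      \<open>K\<close> that vanishes on \<open>I\<close>.\<close>
    have h: "g \<circ> (+>\<^bsub>A\<^esub>) I \<in> alg_hom K A (self_algebra K)" using alg_hom_comp[OF p(1) g] .
    have "ring (quot_algebra A I)" "ring (self_algebra K)"
      using algebra.M_cring[OF quot_algebra_algebra[OF alg Ii]]
        algebra.M_cring[OF self_algebra_algebra[OF K.is_cring]] cring.axioms(1) by blast+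
    then have "g \<zero>\<^bsub>quot_algebra A I\<^esub> = \<zero>\<^bsub>K\<^esub>" using alg_hom_zero[OF _ _ g] by simp
    then have "(g \<circ> (+>\<^bsub>A\<^esub>) I) f = \<zero>\<^bsub>K\<^esub>" if "f \<in> I" for f
      using that p(3)[of f] ideal.Icarr[OF Ii] by auto
    then have disj: "I \<inter> nonvanishing K A = {}" using h unfolding nonvanishing_def by blast
    \<comment> \<open>An ideal disjoint from \<open>S\<close> misses the unit, hence is proper, so
      maximality among all proper ideals suffices.\<close>
    have "J = I" if "ideal J A" "J \<inter> nonvanishing K A = {}" "I \<subseteq> J" for J
    proof -
      have "\<one>\<^bsub>A\<^esub> \<notin> J" using that(2) one by blast
      then have "J \<noteq> carrier A" using A.one_closed by auto
      moreover have "J \<subseteq> carrier A" using ideal.Icarr[OF that(1)] by blast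
      ultimately show ?thesis using maximalideal.I_maximal[OF I that(1,3)] by blast
    qed
    then show "maximal_disjoint_ideal A (nonvanishing K A) I"
      unfolding maximal_disjoint_ideal_def using Ii disj by blast
  }
qed

end
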